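(* Let $K$ be a field, $P=K[x_1,\dots,x_n]$, let $\mathcal{O}=\{t_1,\dots,t_\mu\}$ be a (nonempty) order ideal of monomials in $P$ and let $\sigma$ be a term ordering on $\mathbb{T}^n$. For a $K$-rational point $\mathbf{a}=(a_{ij})$ of $\mathbb{G}_{\mathcal{O},\sigma}$ let $g_j^*(\mathbf{a})\in P$ be obtained from $g_j^*$ by substituting $c_{ij}\mapsto a_{ij}$ ($j=1,\dots,\eta$), and let $I_{\mathbf{a}}=(g_1^*(\mathbf{a}),\dots,g_\eta^*(\mathbf{a}))\subseteq P$. Then: a) $\mathbb{G}_{\mathcal{O},\sigma}$ parametrizes all zero-dimensional ideals $I$ of $P$ for which $\mathcal{O}=\mathcal{O}_\sigma(I)$; that is, $\mathbf{a}\mapsto I_{\mathbf{a}}$ is a bijection from the set of $K$-rational points of $\mathbb{G}_{\mathcal{O},\sigma}$ onto the set of zero-dimensional ideals $I\subset P$ with $\mathcal{O}_\sigma(I)=\mathcal{O}$. b) The fibers over the $K$-rational points of the universal $(\mathcal{O},\sigma)$-Gröbner basis family $\Psi:G_{\mathcal{O},\sigma}\to U_{\mathcal{O},\sigma}$ are the quotient rings $P/I$ for which $I$ is a zero-dimensional ideal with $\mathcal{O}=\mathcal{O}_\sigma(I)$ (the fiber over $\mathbf{a}$ being $P/I_{\mathbf{a}}$). Moreover, the reduced $\sigma$-Gröbner basis of $I=I_{\mathbf{a}}$ is $\{g_1^*(\mathbf{a}),\dots,g_\eta^*(\mathbf{a})\}$, i.e. it is obtained by specializing the generic $(\mathcal{O},\sigma)$-Gröbner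 prebasis $\{g_1^*,\dots,g_\eta^*\}$ at the corresponding maximal linear ideal $(c_{ij}-a_{ij}\mid c_{ij}\in S_{c\mathcal{O},\sigma})$.
   Context: Notation: $\mathbf{x}=x_1,\dots,x_n$, $\mathbb{T}^n=\{x_1^{\alpha_1}\cdots x_n^{\alpha_n}\mid\alpha_i\ge0\}$. An order ideal is a finite set $\mathcal{O}=\{t_1,\dots,t_\mu\}\subset\mathbb{T}^n$ (here nonempty) closed under taking divisors. Its border is $\partial\mathcal{O}=(x_1\mathcal{O}\cup\dots\cup x_n\mathcal{O})\setminus\mathcal{O}=\{b_1,\dots,b_\nu\}$. The corners $c\mathcal{O}\subseteq\partial\mathcal{O}$ are the minimal generators of the monoid ideal $\mathbb{T}^n\setminus\mathcal{O}$; the labelling is chosen so that $c\mathcal{O}=\{b_1,\dots,b_\eta\}$, $\eta\le\nu$. For an ideal $I\subseteq P$, $\mathcal{O}_\sigma(I)$ is the set of terms in $\mathbb{T}^n$ that are not $\sigma$-leading terms of nonzero elements of $I$. Let $\mathbf{c}=\{c_{ij}\mid 1\le i\le\mu,1\le j\le\nu\}$ be new indeterminates. For $k=1,\dots,n$ the generic multiplication matrix $\mathcal{A}_k\in\mathrm{Mat}_\mu(K[\mathbf{c}])$ has $(i,j)$ entry $\delta_{im}$ if $x_kt_j=t_m\in\mathcal{O}$, and $c_{im}$ if $x_kt_j=b_m\in\partial\mathcal{O}$. $I(\mathbb{B}_{\mathcal{O}})\subseteq K[\mathbf{c}]$ is the ideal generated by all entries of all $\mathcal{A}_k\mathcal{A}_\ell-\mathcal{A}_\ell\mathcal{A}_k$,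 $1\le k<\ell\le n$. $S_{\mathcal{O},\sigma}=\{c_{ij}\mid b_j>_\sigma t_i\}$; $L_{\mathcal{O},\sigma}$ is the ideal of $K[\mathbf{c}]$ generated by the $c_{ij}\notin S_{\mathcal{O},\sigma}$; $S_{c\mathcal{O},\sigma}=\{c_{ij}\in S_{\mathcal{O},\sigma}\mid j\le\eta\}$. For $j=1,\dots,\eta$ let $g_j^*=b_j-\sum_{\{i\mid b_j>_\sigma t_i\}}c_{ij}t_i$ (the generic $(\mathcal{O},\sigma)$-Gröbner prebasis). $I(\mathbb{G}_{\mathcal{O},\sigma})=(L_{\mathcal{O},\sigma}+I(\mathbb{B}_{\mathcal{O}}))\cap K[S_{c\mathcal{O},\sigma}]$; $G_{\mathcal{O},\sigma}=K[S_{c\mathcal{O},\sigma}]/I(\mathbb{G}_{\mathcal{O},\sigma})$; $\mathbb{G}_{\mathcal{O},\sigma}=\mathrm{Spec}(G_{\mathcal{O},\sigma})$, a closed subscheme of the affine space with coordinates $S_{c\mathcal{O},\sigma}$; $U_{\mathcal{O},\sigma}=K[\mathbf{x},S_{c\mathcal{O},\sigma}]/(I(\mathbb{G}_{\mathcal{O},\sigma})+(g_1^*,\dots,g_\eta^* ))$; $\Psi$ is the natural $K$-algebra homomorphism. The fiber of $\Psi$ over a $K$-rational point with maximal ideal $\mathfrak{n}\subset G_{\mathcal{O},\sigma}$ is $U_{\mathcal{O},\sigma}/\mathfrak{n}U_{\mathcal{O},\sigma}$. *)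

theory Defs
  imports "HOL-Library.Poly_Mapping" "HOL-Library.FuncSet" "HOL-Algebra.QuotRing"
begin

section \<open>Polynomials\<close>

text \<open>
  A term in indeterminates from \<open>'v\<close> is its exponent vector, so multiplication of terms is
  written additively: \<open>0\<close> is the term 1.
\<close>

type_synonym 'v trm = "'v \<Rightarrow>\<^sub>0 nat"
type_synonym ('v, 'k) mpoly = "'v trm \<Rightarrow>\<^sub>0 'k"

definition Const :: "'k::comm_ring_1 \<Rightarrow> ('v, 'k) mpoly"
  where "Const a = Poly_Mapping.single 0 a"

definition Var :: "'v \<Rightarrow> ('v, 'k::comm_ring_1) mpoly"
  where "Var v = Poly_Mapping.single (Poly_Mapping.single v 1) 1"

definition Term :: "'v trm \<Rightarrow> ('v, 'k::comm_ring_1) mpoly"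
  where "Term t = Poly_Mapping.single t 1"

definition subst ::
    "('k::comm_ring_1 \<Rightarrow> 'r::comm_ring_1) \<Rightarrow> ('v \<Rightarrow> 'r) \<Rightarrow> ('v, 'k) mpoly \<Rightarrow> 'r"
  where "subst \<phi> f p =
    (\<Sum>m\<in>Poly_Mapping.keys p. \<phi> (Poly_Mapping.lookup p m) *
      (\<Prod>v\<in>Poly_Mapping.keys m. f v ^ Poly_Mapping.lookup m v))"

definition rename :: "('v \<Rightarrow> 'w) \<Rightarrow> ('v, 'k::comm_ring_1) mpoly \<Rightarrow> ('w, 'k) mpoly"
  where "rename f = subst Const (\<lambda>v. Var (f v))"

text \<open>The polynomial ring over \<open>'k\<close> in the indeterminates belonging to the set \<open>V\<close>.\<close>

definition poly_ring :: "'v set \<Rightarrow> ('v, 'k::comm_ring_1) mpoly ring"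
  where "poly_ring V =
    \<lparr>carrier = {p. \<forall>m\<in>Poly_Mapping.keys p. Poly_Mapping.keys m \<subseteq> V},
     mult = (*), one = 1, zero = 0, add = (+)\<rparr>"

text \<open>Krull dimension zero: the quotient is not zero, and all its primes are maximal.\<close>

definition zero_dimensional :: "('a, 'b) ring_scheme \<Rightarrow> 'a set \<Rightarrow> bool"
  where "zero_dimensional R I \<longleftrightarrow> ideal I R \<and> I \<noteq> carrier R \<and>
    (\<forall>\<pp>. primeideal \<pp> R \<and> I \<subseteq> \<pp> \<longrightarrow> maximalideal \<pp> R)"


section \<open>Term orderings and Groebner bases\<close>

definition tdvd :: "'v trm \<Rightarrow> 'v trm \<Rightarrow> bool"
  where "tdvd s t \<longleftrightarrow> (\<exists>u. t = s + u)"

text \<open>\<open>(s, t) \<in> \<sigma>\<close> is read as \<open>s \<le>\<^sub>\<sigma> t\<close>.\<close>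

definition term_ordering :: "'v trm rel \<Rightarrow> bool"
  where "term_ordering \<sigma> \<longleftrightarrow> linear_order \<sigma> \<and> (\<forall>t. (0, t) \<in> \<sigma>) \<and>
    (\<forall>s t u. (s, t) \<in> \<sigma> \<longrightarrow> (s + u, t + u) \<in> \<sigma>)"

definition lead_term :: "'v trm rel \<Rightarrow> ('v, 'k::comm_ring_1) mpoly \<Rightarrow> 'v trm"
  where "lead_term \<sigma> p =
    (THE t. t \<in> Poly_Mapping.keys p \<and> (\<forall>s\<in>Poly_Mapping.keys p. (s, t) \<in> \<sigma>))"

text \<open>The set usually written \<open>\<O>\<^sub>\<sigma>(I)\<close>.\<close>

definition complement_of_lead_terms ::
    "'v trm rel \<Rightarrow> ('v, 'k::comm_ring_1) mpoly set \<Rightarrow> 'v trm set"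
  where "complement_of_lead_terms \<sigma> I = - (lead_term \<sigma> ` (I - {0}))"

definition groebner_basis ::
    "'v trm rel \<Rightarrow> ('v, 'k::comm_ring_1) mpoly set \<Rightarrow> ('v, 'k) mpoly set \<Rightarrow> bool"
  where "groebner_basis \<sigma> I B \<longleftrightarrow> finite B \<and> B \<subseteq> I - {0} \<and>
    (\<forall>f\<in>I - {0}. \<exists>g\<in>B. tdvd (lead_term \<sigma> g) (lead_term \<sigma> f))"

definition reduced_groebner_basis ::
    "'v trm rel \<Rightarrow> ('v, 'k::comm_ring_1) mpoly set \<Rightarrow> ('v, 'k) mpoly set \<Rightarrow> bool"
  where "reduced_groebner_basis \<sigma> I B \<longleftrightarrow> groebner_basis \<sigma> I B \<and>
    (\<forall>g\<in>B. Poly_Mapping.lookup g (lead_term \<sigma> g) = 1 \<and>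
      (\<forall>t\<in>Poly_Mapping.keys g. \<forall>h\<in>B - {g}. \<not> tdvd (lead_term \<sigma> h) t))"


section \<open>Order ideals\<close>

definition order_ideal :: "'x trm set \<Rightarrow> bool"
  where "order_ideal \<O> \<longleftrightarrow> finite \<O> \<and> \<O> \<noteq> {} \<and> (\<forall>t\<in>\<O>. \<forall>s. tdvd s t \<longrightarrow> s \<in> \<O>)"

definition border :: "'x trm set \<Rightarrow> 'x trm set"
  where "border \<O> = {Poly_Mapping.single k 1 + t | k t. t \<in> \<O>} - \<O>"

definition corners :: "'x trm set \<Rightarrow> 'x trm set"
  where "corners \<O> = {b. b \<notin> \<O> \<and> (\<forall>s. s \<notin> \<O> \<and> tdvd s b \<longrightarrow> s = b)}"


section \<open>The border basis scheme\<close>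

text \<open>
  Instead of numbering \<open>\<O>\<close> and its border, rows, columns and indeterminates are indexed by the
  terms themselves: if \<open>t\<close> is the \<open>i\<close>th element of \<open>\<O>\<close> and \<open>b\<close> the \<open>j\<close>th border term, then
  \<open>Var (t, b)\<close> is the indeterminate \<open>c\<^sub>i\<^sub>j\<close>.
\<close>

type_synonym 'x cidx = "'x trm \<times> 'x trm"

definition c_indices :: "'x trm set \<Rightarrow> 'x cidx set"
  where "c_indices \<O> = \<O> \<times> border \<O>"

abbreviation Kc :: "'x trm set \<Rightarrow> ('x cidx, 'k::field) mpoly ring"
  where "Kc \<O> \<equiv> poly_ring (c_indices \<O>)"

definition mult_matrix ::
    "'x trm set \<Rightarrow> 'x \<Rightarrow> 'x trm \<Rightarrow> 'x trm \<Rightarrow> ('x cidx, 'k::field) mpoly"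
  where "mult_matrix \<O> k s t =
    (let xt = Poly_Mapping.single k 1 + t in
     if xt \<in> \<O> then (if s = xt then 1 else 0) else Var (s, xt))"

text \<open>
  All pairs \<open>k, l\<close> are allowed; swapping them only changes the sign, and \<open>k = l\<close> contributes 0.
\<close>

definition border_scheme_ideal :: "'x trm set \<Rightarrow> ('x cidx, 'k::field) mpoly set"
  where "border_scheme_ideal \<O> = Idl\<^bsub>Kc \<O>\<^esub>
    {(\<Sum>u\<in>\<O>. mult_matrix \<O> k s u * mult_matrix \<O> l u t) -
     (\<Sum>u\<in>\<O>. mult_matrix \<O> l s u * mult_matrix \<O> k u t) | k l s t. s \<in> \<O> \<and> t \<in> \<O>}"


section \<open>The Groebner basis scheme and its universal family\<close>

definition S_full :: "'x trm set \<Rightarrow> 'x trm rel \<Rightarrow> 'x cidx set"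
  where "S_full \<O> \<sigma> = {(t, b) \<in> c_indices \<O>. (t, b) \<in> \<sigma> \<and> t \<noteq> b}"

definition S_corner :: "'x trm set \<Rightarrow> 'x trm rel \<Rightarrow> 'x cidx set"
  where "S_corner \<O> \<sigma> = {(t, b) \<in> S_full \<O> \<sigma>. b \<in> corners \<O>}"

definition L_ideal :: "'x trm set \<Rightarrow> 'x trm rel \<Rightarrow> ('x cidx, 'k::field) mpoly set"
  where "L_ideal \<O> \<sigma> = Idl\<^bsub>Kc \<O>\<^esub> (Var ` (c_indices \<O> - S_full \<O> \<sigma>))"

abbreviation KS :: "'x trm set \<Rightarrow> 'x trm rel \<Rightarrow> ('x cidx, 'k::field) mpoly ring"
  where "KS \<O> \<sigma> \<equiv> poly_ring (S_corner \<O> \<sigma>)"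

definition gb_scheme_ideal :: "'x trm set \<Rightarrow> 'x trm rel \<Rightarrow> ('x cidx, 'k::field) mpoly set"
  where "gb_scheme_ideal \<O> \<sigma> =
    (L_ideal \<O> \<sigma> <+>\<^bsub>Kc \<O>\<^esub> border_scheme_ideal \<O>) \<inter> carrier (KS \<O> \<sigma>)"

definition G_ring :: "'x trm set \<Rightarrow> 'x trm rel \<Rightarrow> ('x cidx, 'k::field) mpoly set ring"
  where "G_ring \<O> \<sigma> = KS \<O> \<sigma> Quot gb_scheme_ideal \<O> \<sigma>"

text \<open>
  \<open>K[\<^bold>x, S]\<close> has the indeterminates \<open>x\<^sub>k = Var (Inl k)\<close> and \<open>c\<^sub>i\<^sub>j = Var (Inr (t, b))\<close>.
\<close>

abbreviation KxS :: "'x trm set \<Rightarrow> 'x trm rel \<Rightarrow> ('x + 'x cidx, 'k::field) mpoly ring"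
  where "KxS \<O> \<sigma> \<equiv> poly_ring (range Inl \<union> Inr ` S_corner \<O> \<sigma>)"

definition g_star ::
    "'x trm set \<Rightarrow> 'x trm rel \<Rightarrow> 'x trm \<Rightarrow> ('x + 'x cidx, 'k::field) mpoly"
  where "g_star \<O> \<sigma> b = rename Inl (Term b) -
    (\<Sum>t | t \<in> \<O> \<and> (t, b) \<in> \<sigma> \<and> t \<noteq> b. Var (Inr (t, b)) * rename Inl (Term t))"

definition U_ideal :: "'x trm set \<Rightarrow> 'x trm rel \<Rightarrow> ('x + 'x cidx, 'k::field) mpoly set"
  where "U_ideal \<O> \<sigma> =
    Idl\<^bsub>KxS \<O> \<sigma>\<^esub> (rename Inr ` gb_scheme_ideal \<O> \<sigma>) <+>\<^bsub>KxS \<O> \<sigma>\<^esub>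
    Idl\<^bsub>KxS \<O> \<sigma>\<^esub> (g_star \<O> \<sigma> ` corners \<O>)"

definition U_ring :: "'x trm set \<Rightarrow> 'x trm rel \<Rightarrow> ('x + 'x cidx, 'k::field) mpoly set ring"
  where "U_ring \<O> \<sigma> = KxS \<O> \<sigma> Quot U_ideal \<O> \<sigma>"

text \<open>The natural map sends the residue class of \<open>f \<in> K[S]\<close> to that of \<open>f \<in> K[\<^bold>x, S]\<close>.\<close>

definition Psi ::
    "'x trm set \<Rightarrow> 'x trm rel \<Rightarrow> ('x cidx, 'k::field) mpoly set \<Rightarrow> ('x + 'x cidx, 'k) mpoly set"
  where "Psi \<O> \<sigma> X = the_elem ((\<lambda>f. U_ideal \<O> \<sigma> +>\<^bsub>KxS \<O> \<sigma>\<^esub> rename Inr f) ` X)"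


section \<open>Rational points, fibers and specialization\<close>

text \<open>
  Coordinate tuples are functions on \<open>S_corner \<O> \<sigma>\<close>, fixed to \<open>undefined\<close> elsewhere, so that
  distinct functions are distinct points.
\<close>

definition rational_points :: "'x trm set \<Rightarrow> 'x trm rel \<Rightarrow> ('x cidx \<Rightarrow> 'k::field) set"
  where "rational_points \<O> \<sigma> =
    {a \<in> S_corner \<O> \<sigma> \<rightarrow>\<^sub>E UNIV. \<forall>f\<in>gb_scheme_ideal \<O> \<sigma>. subst id a f = 0}"

text \<open>The image in \<open>G_ring \<O> \<sigma>\<close> of the linear ideal generated by the \<open>c\<^sub>i\<^sub>j - a\<^sub>i\<^sub>j\<close>.\<close>

definition point_ideal ::
    "'x trm set \<Rightarrow> 'x trm rel \<Rightarrow> ('x cidx \<Rightarrow> 'k::field) \<Rightarrow> ('x cidx, 'k) mpoly set set"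
  where "point_ideal \<O> \<sigma> a = Idl\<^bsub>G_ring \<O> \<sigma>\<^esub>
    ((\<lambda>c. gb_scheme_ideal \<O> \<sigma> +>\<^bsub>KS \<O> \<sigma>\<^esub> (Var c - Const (a c))) ` S_corner \<O> \<sigma>)"

definition fiber_ideal ::
    "'x trm set \<Rightarrow> 'x trm rel \<Rightarrow> ('x cidx, 'k::field) mpoly set set
      \<Rightarrow> ('x + 'x cidx, 'k) mpoly set set"
  where "fiber_ideal \<O> \<sigma> \<nn> = Idl\<^bsub>U_ring \<O> \<sigma>\<^esub> (Psi \<O> \<sigma> ` \<nn>)"

definition fiber ::
    "'x trm set \<Rightarrow> 'x trm rel \<Rightarrow> ('x cidx, 'k::field) mpoly set set
      \<Rightarrow> ('x + 'x cidx, 'k) mpoly set set ring"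
  where "fiber \<O> \<sigma> \<nn> = U_ring \<O> \<sigma> Quot fiber_ideal \<O> \<sigma> \<nn>"

definition fiber_class ::
    "'x trm set \<Rightarrow> 'x trm rel \<Rightarrow> ('x cidx, 'k::field) mpoly set set
      \<Rightarrow> ('x + 'x cidx, 'k) mpoly \<Rightarrow> ('x + 'x cidx, 'k) mpoly set set"
  where "fiber_class \<O> \<sigma> \<nn> f =
    fiber_ideal \<O> \<sigma> \<nn> +>\<^bsub>U_ring \<O> \<sigma>\<^esub> (U_ideal \<O> \<sigma> +>\<^bsub>KxS \<O> \<sigma>\<^esub> f)"

definition specialize ::
    "('x cidx \<Rightarrow> 'k::field) \<Rightarrow> ('x + 'x cidx, 'k) mpoly \<Rightarrow> ('x, 'k) mpoly"
  where "specialize a = subst Const (case_sum Var (\<lambda>c. Const (a c)))"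

definition P_ring :: "('x, 'k::field) mpoly ring"
  where "P_ring = poly_ring UNIV"

definition specialized_prebasis ::
    "'x trm set \<Rightarrow> 'x trm rel \<Rightarrow> ('x cidx \<Rightarrow> 'k::field) \<Rightarrow> ('x, 'k) mpoly set"
  where "specialized_prebasis \<O> \<sigma> a = (\<lambda>b. specialize a (g_star \<O> \<sigma> b)) ` corners \<O>"

definition point_to_ideal ::
    "'x trm set \<Rightarrow> 'x trm rel \<Rightarrow> ('x cidx \<Rightarrow> 'k::field) \<Rightarrow> ('x, 'k) mpoly set"
  where "point_to_ideal \<O> \<sigma> a = Idl\<^bsub>P_ring\<^esub> (specialized_prebasis \<O> \<sigma> a)"

definition ideals_with_complement ::
    "'x trm set \<Rightarrow> 'x trm rel \<Rightarrow> ('x, 'k::field) mpoly set set"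
  where "ideals_with_complement \<O> \<sigma> =
    {I. zero_dimensional P_ring I \<and> complement_of_lead_terms \<sigma> I = \<O>}"

text \<open>
  Isomorphisms are taken over \<open>K[\<^bold>x]\<close>, hence are isomorphisms of \<open>K\<close>-algebras: the residue
  class of a polynomial \<open>p\<close> in the \<open>x\<^sub>k\<close> corresponds to the residue class of \<open>p\<close>.
\<close>

definition fiber_iso_quotient ::
    "'x trm set \<Rightarrow> 'x trm rel \<Rightarrow> ('x cidx, 'k::field) mpoly set set \<Rightarrow> ('x, 'k) mpoly set \<Rightarrow> bool"
  where "fiber_iso_quotient \<O> \<sigma> \<nn> I \<longleftrightarrow>
    (\<exists>\<phi>\<in>ring_iso (fiber \<O> \<sigma> \<nn>) (P_ring Quot I).
      \<forall>p\<in>carrier P_ring. \<phi> (fiber_class \<O> \<sigma> \<nn> (rename Inl p)) = I +>\<^bsub>P_ring\<^esub> p)"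

end

theory Submission
  imports Defs "HOL-Library.Multiset" "HOL-Algebra.Multiplicative_Group" HOL.Topological_Spaces
begin

text \<open>
  Ideals \<open>I\<close> with \<open>\<O>\<^sub>\<sigma>(I) = \<O>\<close> are the same thing as commuting multiplication matrices on the span of
  \<open>\<O>\<close> that respect \<open>\<sigma>\<close>. A tuple of values for all \<open>c\<^sub>i\<^sub>j\<close> kills \<open>L_ideal\<close> and
  \<open>border_scheme_ideal\<close> exactly when \<open>c\<^sub>i\<^sub>j\<close> gets the value \<open>0\<close> unless \<open>t\<^sub>i < b\<^sub>j\<close> and the specialized
  matrices commute (\<open>vanishing_on_J_iff\<close>).

  From matrices to ideals: commuting matrices let \<open>K[x]\<close> act on the span of \<open>\<O>\<close>. Acting on the
  term 1 gives a linear map \<open>\<phi>\<close> from \<open>K[x]\<close> onto that span; it fixes \<open>\<O>\<close>, sends a term to terms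
  that are not larger, and its kernel is an ideal containing the specialized prebasis. A lead term in
  \<open>\<O>\<close> of some \<open>f\<close> in the kernel would survive in \<open>\<phi>(f) = 0\<close>, so the ideal generated by the prebasis
  has no lead term in \<open>\<O>\<close> (\<open>prebasis_ideal_lead_term_notin_O\<close>). Its generators have the corners as
  lead terms, and every term outside \<open>\<O>\<close> is a multiple of a corner; this yields both
  \<open>\<O>\<^sub>\<sigma>(I) = \<O>\<close> and the reduced Groebner basis.

  From ideals to matrices: term orderings are well-founded by Dickson's lemma, so every
  polynomial has a unique normal form supported on \<open>\<O>\<close> modulo \<open>I\<close>. The normal forms of
  the border terms are the structure constants of \<open>K[x]/I\<close>, and these matrices commute because
  multiplication is commutative (\<open>commuting_coord\<close>). As \<open>K[x]/I\<close> has finite dimension, its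
  primes are maximal (\<open>prime_maximal\<close>).

  Coordinates: the Groebner basis scheme keeps only the \<open>c\<^sub>i\<^sub>j\<close> with \<open>b\<^sub>j\<close> a corner. A border
  term that is not a corner has the form \<open>x\<^sub>k x\<^sub>l t\<close> with \<open>x\<^sub>k t \<in> \<O>\<close> and \<open>x\<^sub>l t\<close> in the border, and
  one entry of the commutator of the \<open>k\<close>th and \<open>l\<close>th matrices writes its coefficients, modulo
  \<open>L_ideal\<close>, as polynomials in coefficients of smaller border terms (\<open>reducible_Var\<close>). So every
  polynomial in all \<open>c\<^sub>i\<^sub>j\<close> is congruent to one in the coordinates of the Groebner basis scheme, and
  a rational point extends to a full tuple over the same field \<open>K\<close> (\<open>extend_point\<close>). This turns the two
  constructions above into the bijection \<open>bij_betw_point_to_ideal\<close>.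

  Fibers: both the fiber over \<open>a\<close> and \<open>P/I\<^sub>a\<close> are quotients of \<open>K[x, S]\<close>, and both maps kill
  exactly the polynomials whose specialization at \<open>a\<close> lies in \<open>I\<^sub>a\<close> (\<open>coset_in_FI_iff\<close>).
\<close>

section \<open>Terms\<close>

lemma keys_add_trm: "Poly_Mapping.keys (s + t :: 'v trm) = Poly_Mapping.keys s \<union> Poly_Mapping.keys t"
  by (auto simp: in_keys_iff lookup_add)

lemma trm_split:
  fixes m :: "'v trm"
  assumes "k \<in> Poly_Mapping.keys m"
  shows "m = Poly_Mapping.single k 1 + (m - Poly_Mapping.single k 1)"
  using assms by (intro poly_mapping_eqI) (auto simp: lookup_add lookup_minus lookup_single in_keys_iff when_def)

text \<open>
  The exponent vector as a multiset of indeterminates, which makes multiset induction and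
  \<open>fold_mset\<close> available for terms.
\<close>

definition trm_mset :: "'v trm \<Rightarrow> 'v multiset"
  where "trm_mset m = Abs_multiset (Poly_Mapping.lookup m)"

lemma count_trm_mset [simp]: "count (trm_mset m) = Poly_Mapping.lookup m"
  unfolding trm_mset_def
  by (rule Abs_multiset_inverse) (simp)

lemma trm_mset_0 [simp]: "trm_mset 0 = {#}"
  by (rule multiset_eqI) simp

lemma trm_mset_single_add: "trm_mset (Poly_Mapping.single k 1 + m) = add_mset k (trm_mset m)"
  by (rule multiset_eqI) (simp add: lookup_add lookup_single when_def)

lemma trm_mset_eq_iff [simp]: "trm_mset m = trm_mset m' \<longleftrightarrow> m = m'"
  by (metis count_trm_mset poly_mapping_eq_iff)

lemma trm_induct [case_names zero var_add]:
  fixes m :: "'v trm"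
  assumes "P 0" and step: "\<And>k m. P m \<Longrightarrow> P (Poly_Mapping.single k 1 + m)"
  shows "P m"
proof (induction "trm_mset m" arbitrary: m)
  case empty
  then show ?case using assms(1) by (metis trm_mset_0 trm_mset_eq_iff)
next
  case (add k M)
  have "k \<in> Poly_Mapping.keys m"
    using add.hyps(2) by (metis count_trm_mset count_eq_zero_iff in_keys_iff union_single_eq_member)
  then have m: "m = Poly_Mapping.single k 1 + (m - Poly_Mapping.single k 1)" by (rule trm_split)
  then have "trm_mset m = add_mset k (trm_mset (m - Poly_Mapping.single k 1))"
    by (metis trm_mset_single_add)
  then have "M = trm_mset (m - Poly_Mapping.single k 1)" using add.hyps(2) by simp
  then show ?case using add.hyps(1) step m by metis
qed

text \<open>
  A term is a multiset of indeterminates, so a commuting family of operators, one for each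
  indeterminate, acts on any starting vector through terms.
\<close>

lemma commuting_operators_act_on_terms:
  fixes F :: "'v \<Rightarrow> 'a \<Rightarrow> 'a"
  assumes "\<And>k l p. F k (F l p) = F l (F k p)"
  shows "\<exists>N :: 'v trm \<Rightarrow> 'a. N 0 = p0 \<and> (\<forall>k m. N (Poly_Mapping.single k 1 + m) = F k (N m))"
proof -
  interpret comp_fun_commute F by unfold_locales (simp add: fun_eq_iff assms)
  define N :: "'v trm \<Rightarrow> 'a" where "N m = fold_mset F p0 (trm_mset m)" for m
  have "N 0 = p0" by (simp add: N_def)
  moreover have "N (Poly_Mapping.single k 1 + m) = F k (N m)" for k m
    unfolding N_def trm_mset_single_add by (rule fold_mset_add_mset)
  ultimately show ?thesis by blast
qed

section \<open>Polynomials and substitution\<close>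

lemma lookup_Const_mult [simp]: "Poly_Mapping.lookup (Const c * p) s = c * Poly_Mapping.lookup p s"
  unfolding Const_def mult_map_scale_conv_mult[symmetric]
  by (simp add: Poly_Mapping.map.rep_eq when_def)

lemma Const_0 [simp]: "Const 0 = 0" and Const_1 [simp]: "Const 1 = 1"
  and Const_add: "Const (a + b) = Const a + Const b"
  and Const_mult: "Const (a * b) = Const a * Const b"
  by (simp_all add: Const_def single_add mult_single)

lemma lookup_Term: "Poly_Mapping.lookup (Term t) s = (if s = t then 1 else 0)"
  by (auto simp: Term_def lookup_single when_def)

lemma Term_add: "Term (s + t) = Term s * Term t"
  by (simp add: Term_def mult_single)

lemma Term_0 [simp]: "Term 0 = 1"
  by (simp add: Term_def)

lemma Term_single: "Term (Poly_Mapping.single k 1) = Var k"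
  by (simp add: Term_def Var_def)

lemma mpoly_expansion: "p = (\<Sum>m\<in>Poly_Mapping.keys p. Const (Poly_Mapping.lookup p m) * Term m)"
  by (rule poly_mapping_eqI) (auto simp: lookup_sum lookup_Term in_keys_iff sum.delta' if_distrib cong: if_cong)

text \<open>
  Induction along a linear combination of terms, for statements that are linear in the polynomial;
  \<open>poly_ring_induct\<close> below is the counterpart for statements compatible with products.
\<close>

lemma mpoly_linear_induct [case_names zero add]:
  assumes "P 0" and "\<And>a m p. P p \<Longrightarrow> P (Const a * Term m + p)"
  shows "P p"
proof -
  have "P (\<Sum>m\<in>A. Const (Poly_Mapping.lookup p m) * Term m)" if "finite A" for A
    using that by (induction A) (use assms in auto)
  then show ?thesis using mpoly_expansion[of p] finite_keys by metis
qed

lemma lookup_eq_0 [simp]: "m \<notin> Poly_Mapping.keys p \<Longrightarrow> Poly_Mapping.lookup p m = 0"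
  by (simp add: in_keys_iff)

lemma
  fixes p q :: "('v, 'k::comm_ring_1) mpoly"
  shows keys_add_subset: "Poly_Mapping.keys p \<subseteq> A \<Longrightarrow> Poly_Mapping.keys q \<subseteq> A \<Longrightarrow> Poly_Mapping.keys (p + q) \<subseteq> A"
    and keys_diff_subset: "Poly_Mapping.keys p \<subseteq> A \<Longrightarrow> Poly_Mapping.keys q \<subseteq> A \<Longrightarrow> Poly_Mapping.keys (p - q) \<subseteq> A"
    and keys_Const_mult_subset: "Poly_Mapping.keys p \<subseteq> A \<Longrightarrow> Poly_Mapping.keys (Const c * p) \<subseteq> A"
proof -
  show "Poly_Mapping.keys p \<subseteq> A \<Longrightarrow> Poly_Mapping.keys q \<subseteq> A \<Longrightarrow> Poly_Mapping.keys (p + q) \<subseteq> A"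
    using keys_add[of p q] by blast
  show "Poly_Mapping.keys p \<subseteq> A \<Longrightarrow> Poly_Mapping.keys q \<subseteq> A \<Longrightarrow> Poly_Mapping.keys (p - q) \<subseteq> A"
    using keys_diff[of p q] by blast
  have "Poly_Mapping.keys (Const c * p) \<subseteq> Poly_Mapping.keys p"
    by (auto simp: in_keys_iff)
  then show "Poly_Mapping.keys p \<subseteq> A \<Longrightarrow> Poly_Mapping.keys (Const c * p) \<subseteq> A" by blast
qed

lemma keys_sum_subset:
  fixes f :: "'a \<Rightarrow> ('v, 'k::comm_ring_1) mpoly"
  shows "(\<And>x. x \<in> X \<Longrightarrow> Poly_Mapping.keys (f x) \<subseteq> A) \<Longrightarrow> Poly_Mapping.keys (sum f X) \<subseteq> A"
  by (induction X rule: infinite_finite_induct) (simp_all add: keys_add_subset)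

lemmas keys_subset_intros = keys_add_subset keys_diff_subset keys_Const_mult_subset keys_sum_subset

text \<open>
  Evaluation is a ring homomorphism for every homomorphism \<open>\<phi>\<close> of coefficient rings. It is needed for
  \<open>\<phi> = id\<close> (values at points) and \<open>\<phi> = Const\<close> (renaming and specialization).
\<close>

locale coeff_hom =
  fixes \<phi> :: "'k::comm_ring_1 \<Rightarrow> 'r::comm_ring_1"
  assumes \<phi>_0 [simp]: "\<phi> 0 = 0" and \<phi>_1 [simp]: "\<phi> 1 = 1"
    and \<phi>_add [simp]: "\<phi> (a + b) = \<phi> a + \<phi> b" and \<phi>_mult [simp]: "\<phi> (a * b) = \<phi> a * \<phi> b"
begin

lemma subst_superset:
  assumes "finite A" "Poly_Mapping.keys p \<subseteq> A"
  shows "subst \<phi> f p = (\<Sum>m\<in>A. \<phi> (Poly_Mapping.lookup p m) * (\<Prod>v\<in>Poly_Mapping.keys m. f v ^ Poly_Mapping.lookup m v))"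
  unfolding subst_def by (rule sum.mono_neutral_left) (use assms in auto)

lemma subst_0 [simp]: "subst \<phi> f 0 = 0"
  by (simp add: subst_def)

lemma subst_add [simp]: "subst \<phi> f (p + q) = subst \<phi> f p + subst \<phi> f q"
proof -
  let ?A = "Poly_Mapping.keys p \<union> Poly_Mapping.keys q"
  show ?thesis
    using keys_add[of p q]
    by (simp add: subst_superset[where A = ?A] lookup_add distrib_right sum.distrib)
qed

lemma subst_single: "subst \<phi> f (Poly_Mapping.single m a) = \<phi> a * (\<Prod>v\<in>Poly_Mapping.keys m. f v ^ Poly_Mapping.lookup m v)"
  by (simp add: subst_superset[where A = "{m}"])

lemma subst_Const [simp]: "subst \<phi> f (Const a) = \<phi> a"
  by (simp add: Const_def subst_single)

lemma subst_1 [simp]: "subst \<phi> f 1 = 1"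
  using subst_Const[of f 1] by simp

lemma subst_Var [simp]: "subst \<phi> f (Var v) = f v"
  by (simp add: Var_def subst_single)

lemma subst_Term: "subst \<phi> f (Term m) = (\<Prod>v\<in>Poly_Mapping.keys m. f v ^ Poly_Mapping.lookup m v)"
  by (simp add: Term_def subst_single)

lemma subst_Term_add: "subst \<phi> f (Term (m + m')) = subst \<phi> f (Term m) * subst \<phi> f (Term m')"
proof -
  let ?A = "Poly_Mapping.keys m \<union> Poly_Mapping.keys m'"
  have *: "subst \<phi> f (Term n) = (\<Prod>v\<in>?A. f v ^ Poly_Mapping.lookup n v)" if "Poly_Mapping.keys n \<subseteq> ?A" for n
    unfolding subst_Term by (rule prod.mono_neutral_left) (use that in auto)
  show ?thesis using * keys_add[of m m'] by (simp add: lookup_add power_add prod.distrib)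
qed

lemma subst_monomial [simp]: "subst \<phi> f (Const a * Term m) = \<phi> a * subst \<phi> f (Term m)"
  by (simp add: Const_def Term_def mult_single subst_single)

lemma subst_mult [simp]: "subst \<phi> f (p * q) = subst \<phi> f p * subst \<phi> f q"
proof (induction p rule: mpoly_linear_induct)
  case (add a m p)
  have "subst \<phi> f (Const a * Term m * q) = subst \<phi> f (Const a * Term m) * subst \<phi> f q"
  proof (induction q rule: mpoly_linear_induct)
    case (add b n q)
    have "Const a * Term m * (Const b * Term n) = Const (a * b) * Term (m + n)"
      by (simp add: Const_mult Term_add)
    then have "subst \<phi> f (Const a * Term m * (Const b * Term n))
        = subst \<phi> f (Const a * Term m) * subst \<phi> f (Const b * Term n)"
      by (simp only: subst_monomial subst_Term_add \<phi>_mult) (simp only: mult_ac)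
    with add show ?case by (simp only: distrib_left subst_add)
  qed simp
  with add show ?case by (simp only: distrib_right subst_add)
qed simp

lemma subst_minus [simp]: "subst \<phi> f (- p) = - subst \<phi> f p"
  using subst_add[of f p "-p"] by (simp del: subst_add add: eq_neg_iff_add_eq_0 add.commute)

lemma subst_diff [simp]: "subst \<phi> f (p - q) = subst \<phi> f p - subst \<phi> f q"
  using subst_add[of f p "-q"] by simp

lemma subst_sum [simp]: "subst \<phi> f (sum g A) = (\<Sum>x\<in>A. subst \<phi> f (g x))"
  by (induction A rule: infinite_finite_induct) simp_all

end

interpretation id_hom: coeff_hom "id :: 'k \<Rightarrow> 'k::comm_ring_1"
  by unfold_locales simp_all

interpretation Const_hom: coeff_hom "Const :: 'k \<Rightarrow> ('v, 'k::comm_ring_1) mpoly"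
  by unfold_locales (simp_all add: Const_add Const_mult)

declare Const_hom.\<phi>_add [simp del] Const_hom.\<phi>_mult [simp del]

section \<open>Polynomial rings on a set of indeterminates\<close>

lemma poly_ring_simps [simp]:
  "monoid.mult (poly_ring V) = (*)" "monoid.one (poly_ring V) = 1"
  "ring.zero (poly_ring V) = 0" "ring.add (poly_ring V) = (+)"
  by (simp_all add: poly_ring_def)

lemma carrier_poly_ring: "p \<in> carrier (poly_ring V) \<longleftrightarrow> (\<forall>m\<in>Poly_Mapping.keys p. Poly_Mapping.keys m \<subseteq> V)"
  by (simp add: poly_ring_def)

lemma carrier_poly_ring_UNIV [simp]: "carrier (poly_ring UNIV) = UNIV"
  by (auto simp: carrier_poly_ring)

lemma carrier_P_ring [simp]: "carrier P_ring = UNIV"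
  by (simp add: P_ring_def)

lemma poly_ring_mono: "V \<subseteq> W \<Longrightarrow> p \<in> carrier (poly_ring V) \<Longrightarrow> p \<in> carrier (poly_ring W)"
  by (auto simp: carrier_poly_ring)

lemma Const_in_poly_ring [simp]: "Const a \<in> carrier (poly_ring V)"
  by (auto simp: carrier_poly_ring Const_def)

lemma Var_in_poly_ring: "v \<in> V \<Longrightarrow> Var v \<in> carrier (poly_ring V)"
  by (auto simp: carrier_poly_ring Var_def)

lemma one_in_poly_ring [simp]: "1 \<in> carrier (poly_ring V)"
  and zero_in_poly_ring [simp]: "0 \<in> carrier (poly_ring V)"
  using Const_in_poly_ring[of 1 V] Const_in_poly_ring[of 0 V] by simp_all

lemma add_in_poly_ring:
  "p \<in> carrier (poly_ring V) \<Longrightarrow> q \<in> carrier (poly_ring V) \<Longrightarrow> p + q \<in> carrier (poly_ring V)"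
  using keys_add[of p q] unfolding carrier_poly_ring by blast

lemma mult_in_poly_ring:
  "p \<in> carrier (poly_ring V) \<Longrightarrow> q \<in> carrier (poly_ring V) \<Longrightarrow> p * q \<in> carrier (poly_ring V)"
  using keys_mult[of p q] unfolding carrier_poly_ring
  by (fastforce simp: keys_add_trm)

lemma minus_in_poly_ring: "p \<in> carrier (poly_ring V) \<Longrightarrow> - p \<in> carrier (poly_ring V)"
  by (auto simp: carrier_poly_ring in_keys_iff)

lemma diff_in_poly_ring:
  "p \<in> carrier (poly_ring V) \<Longrightarrow> q \<in> carrier (poly_ring V) \<Longrightarrow> p - q \<in> carrier (poly_ring V)"
  using add_in_poly_ring[of p V "-q"] minus_in_poly_ring[of q V] by simp

lemmas poly_ring_closed = Var_in_poly_ring add_in_poly_ring mult_in_poly_ring minus_in_poly_ring diff_in_poly_ring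

lemma sum_in_poly_ring:
  "(\<And>x. x \<in> A \<Longrightarrow> f x \<in> carrier (poly_ring V)) \<Longrightarrow> sum f A \<in> carrier (poly_ring V)"
  by (induction A rule: infinite_finite_induct) (auto intro: poly_ring_closed)

lemma cring_poly_ring: "cring (poly_ring V :: ('v, 'k::comm_ring_1) mpoly ring)"
proof (rule cringI)
  show "abelian_group (poly_ring V :: ('v, 'k) mpoly ring)"
  proof (rule abelian_groupI)
    show "\<exists>y\<in>carrier (poly_ring V). y \<oplus>\<^bsub>poly_ring V\<^esub> x = \<zero>\<^bsub>poly_ring V\<^esub>"
      if "x \<in> carrier (poly_ring V)" for x :: "('v, 'k) mpoly"
      using minus_in_poly_ring[OF that] by (intro bexI[of _ "-x"]) simp_all
  qed (auto intro: poly_ring_closed simp: algebra_simps)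
  show "Group.comm_monoid (poly_ring V :: ('v, 'k) mpoly ring)"
    by (rule comm_monoidI) (auto intro: poly_ring_closed simp: algebra_simps)
qed (auto simp: algebra_simps)

lemma ring_poly_ring: "ring (poly_ring V :: ('v, 'k::comm_ring_1) mpoly ring)"
  using cring_poly_ring by (rule cring.axioms)

lemma a_inv_poly_ring: "p \<in> carrier (poly_ring V) \<Longrightarrow> \<ominus>\<^bsub>poly_ring V\<^esub> p = - p"
  by (rule abelian_group.minus_equality[OF ring.is_abelian_group[OF ring_poly_ring]])
    (simp_all add: minus_in_poly_ring)

lemma a_minus_poly_ring:
  "p \<in> carrier (poly_ring V) \<Longrightarrow> q \<in> carrier (poly_ring V) \<Longrightarrow> p \<ominus>\<^bsub>poly_ring V\<^esub> q = p - q"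
  by (simp add: a_minus_def a_inv_poly_ring)

lemma poly_ring_induct [consumes 1, case_names Const Var add mult]:
  assumes "p \<in> carrier (poly_ring V)"
    and C: "\<And>a. P (Const a)" and V: "\<And>v. v \<in> V \<Longrightarrow> P (Var v)"
    and A: "\<And>p q. P p \<Longrightarrow> P q \<Longrightarrow> P (p + q)" and M: "\<And>p q. P p \<Longrightarrow> P q \<Longrightarrow> P (p * q)"
  shows "P p"
proof -
  have T: "Poly_Mapping.keys m \<subseteq> V \<Longrightarrow> P (Term m)" for m
  proof (induction m rule: trm_induct)
    case zero
    then show ?case using C[of 1] by simp
  next
    case (var_add k m)
    then show ?case by (simp only: Term_add Term_single) (auto intro!: M V simp: keys_add_trm)
  qed
  have "P (\<Sum>m\<in>A. Const (Poly_Mapping.lookup p m) * Term m)"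
    if "finite A" "A \<subseteq> Poly_Mapping.keys p" for A
    using that
  proof (induction A)
    case empty
    then show ?case using C[of 0] by simp
  next
    case (insert x F)
    moreover have "Poly_Mapping.keys x \<subseteq> V" using assms(1) insert.prems by (auto simp: carrier_poly_ring)
    ultimately show ?case by (auto intro!: A M C T)
  qed
  from this[OF finite_keys order_refl] show ?thesis by (subst mpoly_expansion)
qed

text \<open>
  Closure under negation is multiplication by the constant \<open>-1\<close>, so the additive subgroup axioms
  reduce to \<open>0\<close> and addition.
\<close>

lemma ideal_poly_ring_iff:
  "ideal A (poly_ring V) \<longleftrightarrow> A \<subseteq> carrier (poly_ring V) \<and> 0 \<in> A \<and> (\<forall>p\<in>A. \<forall>q\<in>A. p + q \<in> A) \<and>
    (\<forall>r\<in>carrier (poly_ring V). \<forall>p\<in>A. r * p \<in> A)" (is "_ \<longleftrightarrow> ?R")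
proof
  assume "ideal A (poly_ring V)"
  then interpret ideal A "poly_ring V" .
  show ?R
    using a_subset I_l_closed additive_subgroup.zero_closed[OF is_additive_subgroup]
      additive_subgroup.a_closed[OF is_additive_subgroup] by auto
next
  assume R: ?R
  have neg: "- p \<in> A" if "p \<in> A" for p
    using R that minus_in_poly_ring[OF one_in_poly_ring, of V] by fastforce
  show "ideal A (poly_ring V)"
  proof (rule idealI[OF ring_poly_ring])
    show "subgroup A (add_monoid (poly_ring V))"
      using R neg
      by (intro group.subgroupI abelian_group.a_group ring.is_abelian_group ring_poly_ring)
        (auto simp: a_inv_poly_ring[unfolded a_inv_def, simplified] subset_iff)
    show "x \<otimes>\<^bsub>poly_ring V\<^esub> a \<in> A" "a \<otimes>\<^bsub>poly_ring V\<^esub> x \<in> A"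
      if "a \<in> A" "x \<in> carrier (poly_ring V)" for a x
      using R that by (simp_all add: mult.commute[of a])
  qed
qed

lemma ideal_poly_ringD:
  assumes "ideal A (poly_ring V)"
  shows "p \<in> A \<Longrightarrow> p \<in> carrier (poly_ring V)" and "0 \<in> A"
    and "p \<in> A \<Longrightarrow> q \<in> A \<Longrightarrow> p + q \<in> A" and "r \<in> carrier (poly_ring V) \<Longrightarrow> p \<in> A \<Longrightarrow> r * p \<in> A"
    and "p \<in> A \<Longrightarrow> - p \<in> A" and "p \<in> A \<Longrightarrow> q \<in> A \<Longrightarrow> p - q \<in> A"
proof -
  show *: "p \<in> A \<Longrightarrow> p \<in> carrier (poly_ring V)" "0 \<in> A"
    "p \<in> A \<Longrightarrow> q \<in> A \<Longrightarrow> p + q \<in> A" "r \<in> carrier (poly_ring V) \<Longrightarrow> p \<in> A \<Longrightarrow> r * p \<in> A" for p q r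
    using assms by (auto simp: ideal_poly_ring_iff)
  show **: "p \<in> A \<Longrightarrow> - p \<in> A" for p
    using *(4)[of "-1" p] minus_in_poly_ring[OF one_in_poly_ring, of V] by simp
  show "p \<in> A \<Longrightarrow> q \<in> A \<Longrightarrow> p - q \<in> A" using *(3)[of p "-q"] **[of q] by simp
qed

lemma ideal_sum_mem:
  "ideal A (poly_ring V) \<Longrightarrow> (\<And>x. x \<in> X \<Longrightarrow> f x \<in> A) \<Longrightarrow> sum f X \<in> A"
  by (induction X rule: infinite_finite_induct) (auto intro: ideal_poly_ringD)

lemma ideal_P_ringD:
  assumes "ideal A P_ring"
  shows "0 \<in> A" and "p \<in> A \<Longrightarrow> q \<in> A \<Longrightarrow> p + q \<in> A" and "p \<in> A \<Longrightarrow> r * p \<in> A"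
    and "p \<in> A \<Longrightarrow> - p \<in> A" and "p \<in> A \<Longrightarrow> q \<in> A \<Longrightarrow> p - q \<in> A"
  using ideal_poly_ringD[of A UNIV] assms unfolding P_ring_def by auto

lemma ideal_P_ringI:
  assumes "0 \<in> A" and "\<And>p q. p \<in> A \<Longrightarrow> q \<in> A \<Longrightarrow> p + q \<in> A" and "\<And>r p. p \<in> A \<Longrightarrow> r * p \<in> A"
  shows "ideal A P_ring"
  using assms unfolding P_ring_def by (auto simp: ideal_poly_ring_iff)

lemma ideal_P_sum:
  "ideal A P_ring \<Longrightarrow> (\<And>x. x \<in> X \<Longrightarrow> f x \<in> A) \<Longrightarrow> sum f X \<in> A"
  unfolding P_ring_def by (rule ideal_sum_mem)

lemma ideal_P_trans:
  assumes "ideal A P_ring" "p - q \<in> A" "q - r \<in> A"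
  shows "p - r \<in> A"
proof -
  have "p - r = (p - q) + (q - r)" by simp
  then show ?thesis using ideal_P_ringD(2)[OF assms] by (simp only:)
qed

lemma ring_P_ring: "ring P_ring"
  by (simp add: P_ring_def ring_poly_ring)

lemma P_ring_simps [simp]:
  "monoid.mult P_ring = (*)" "monoid.one P_ring = 1" "ring.zero P_ring = 0" "ring.add P_ring = (+)"
  by (simp_all add: P_ring_def)

lemmas P_ring_induct = poly_ring_induct[of _ UNIV, folded P_ring_def, simplified, case_names Const Var add mult]


section \<open>Term orderings\<close>

text \<open>
  Every sequence has a monotone subsequence, and a decreasing one of natural numbers is eventually constant.
\<close>

lemma nat_seq_incseq_subsequence:
  fixes s :: "nat \<Rightarrow> nat"
  shows "\<exists>r. strict_mono r \<and> incseq (\<lambda>n. s (r n))"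
proof -
  obtain r :: "nat \<Rightarrow> nat" where r: "strict_mono r" "monoseq (\<lambda>n. s (r n))"
    using seq_monosub by metis
  show ?thesis
  proof (cases "incseq (\<lambda>n. s (r n))")
    case False
    then have dec: "decseq (\<lambda>n. s (r n))" using r(2) monoseq_iff by blast
    obtain N where N: "\<And>n. s (r N) \<le> s (r n)"
      using ex_has_least_nat[of "\<lambda>_. True" 0 "\<lambda>n. s (r n)"] by auto
    have "s (r (n + N)) = s (r N)" for n
      using N[of "n + N"] decseqD[OF dec, of N "n + N"] by simp
    then have "incseq (\<lambda>n. s (r (n + N)))" by (simp add: incseq_def)
    moreover have "strict_mono (\<lambda>n. r (n + N))" using r(1) by (simp add: strict_mono_def)
    ultimately show ?thesis by (intro exI[of _ "\<lambda>n. r (n + N)"]) simp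
  qed (use r(1) in blast)
qed

lemma tdvd_iff: "tdvd s t \<longleftrightarrow> (\<forall>v. Poly_Mapping.lookup s v \<le> Poly_Mapping.lookup t v)"
proof
  assume *: "\<forall>v. Poly_Mapping.lookup s v \<le> Poly_Mapping.lookup t v"
  have "t = s + (t - s)" by (intro poly_mapping_eqI) (simp add: * lookup_add lookup_minus)
  then show "tdvd s t" unfolding tdvd_def by blast
qed (auto simp: tdvd_def lookup_add)

text \<open>
  Passing to subsequences, one coordinate after the other, makes all exponents weakly increasing.
\<close>

lemma dickson:
  fixes f :: "nat \<Rightarrow> ('x::finite) trm"
  shows "\<exists>i j. i < j \<and> tdvd (f i) (f j)"
proof -
  have *: "\<exists>r. strict_mono r \<and> (\<forall>v\<in>A. incseq (\<lambda>n. Poly_Mapping.lookup (f (r n)) v))" if "finite A" for A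
    using that
  proof (induction A)
    case empty
    show ?case by (intro exI[of _ id]) (simp add: strict_mono_def)
  next
    case (insert v A)
    then obtain r where r: "strict_mono r" "\<And>w. w \<in> A \<Longrightarrow> incseq (\<lambda>n. Poly_Mapping.lookup (f (r n)) w)"
      by blast
    obtain q :: "nat \<Rightarrow> nat" where q: "strict_mono q" "incseq (\<lambda>n. Poly_Mapping.lookup (f (r (q n))) v)"
      using nat_seq_incseq_subsequence[of "\<lambda>n. Poly_Mapping.lookup (f (r n)) v"] by blast
    have "incseq (\<lambda>n. Poly_Mapping.lookup (f (r (q n))) w)" if "w \<in> A" for w
      using r(2)[OF that] strict_mono_mono[OF q(1)] by (simp add: incseq_def monoD)
    moreover have "strict_mono (\<lambda>n. r (q n))" using r(1) q(1) by (simp add: strict_mono_def)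
    ultimately show ?case using q(2) by (intro exI[of _ "\<lambda>n. r (q n)"]) simp
  qed
  then obtain r where r: "strict_mono r" "\<And>v. incseq (\<lambda>n. Poly_Mapping.lookup (f (r n)) v)"
    using *[OF finite_class.finite_UNIV] by blast
  have "tdvd (f (r 0)) (f (r 1))"
    using r(2) by (simp add: tdvd_iff incseq_def)
  moreover have "r 0 < r 1" using r(1) by (simp add: strict_mono_def)
  ultimately show ?thesis by blast
qed

locale term_order =
  fixes \<sigma> :: "('x::finite) trm rel"
  assumes term_ordering: "term_ordering \<sigma>"
begin

abbreviation le (infix "\<preceq>" 50) where "s \<preceq> t \<equiv> (s, t) \<in> \<sigma>"
abbreviation lt (infix "\<prec>" 50) where "s \<prec> t \<equiv> (s, t) \<in> \<sigma> \<and> s \<noteq> t"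

lemma linear_order: "linear_order \<sigma>"
  using term_ordering by (simp add: term_ordering_def)

lemma le_refl [simp]: "t \<preceq> t"
  using linear_order by (auto simp: order_on_defs refl_on_def)

lemma le_trans [trans]: "r \<preceq> s \<Longrightarrow> s \<preceq> t \<Longrightarrow> r \<preceq> t"
  using linear_order by (auto simp: order_on_defs dest: transD)

lemma le_antisym: "s \<preceq> t \<Longrightarrow> t \<preceq> s \<Longrightarrow> s = t"
  using linear_order by (auto simp: order_on_defs dest: antisymD)

lemma le_total: "s \<preceq> t \<or> t \<preceq> s"
  using linear_order by (cases "s = t") (auto simp: order_on_defs total_on_def)

lemma zero_le: "0 \<preceq> t" and add_right_le: "s \<preceq> t \<Longrightarrow> s + u \<preceq> t + u"
  using term_ordering by (auto simp: term_ordering_def)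

lemma add_left_le: "s \<preceq> t \<Longrightarrow> u + s \<preceq> u + t"
  using add_right_le by (simp add: add.commute)

lemma tdvd_imp_le: "tdvd s t \<Longrightarrow> s \<preceq> t"
  using add_left_le[OF zero_le] by (auto simp: tdvd_def)

text \<open>
  In an infinite descending chain Dickson's lemma finds an earlier term that divides a later one,
  although divisors are smaller.
\<close>

lemma wf_lt: "wf {(s, t). s \<prec> t}"
proof (rule wf_iff_no_infinite_down_chain[THEN iffD2], rule notI)
  assume "\<exists>f. \<forall>i. (f (Suc i), f i) \<in> {(s, t). s \<prec> t}"
  then obtain f where f: "\<And>i. f (Suc i) \<prec> f i" by blast
  have "f (Suc (i + n)) \<preceq> f i \<and> f (Suc (i + n)) \<noteq> f i" for i n
  proof (induction n)
    case (Suc n)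
    then show ?case using f[of "Suc (i + n)"] le_trans le_antisym by (metis add_Suc_right)
  qed (use f in simp)
  then have desc: "f j \<prec> f i" if "i < j" for i j
    using less_imp_Suc_add[OF that] by auto
  obtain i j where "i < j" "tdvd (f i) (f j)" using dickson by blast
  then show False using desc[of i j] tdvd_imp_le le_antisym by blast
qed

lemma ex_max: "finite A \<Longrightarrow> A \<noteq> {} \<Longrightarrow> \<exists>t\<in>A. \<forall>s\<in>A. s \<preceq> t"
proof (induction A rule: finite_ne_induct)
  case (insert x A)
  then obtain t where "t \<in> A" "\<forall>s\<in>A. s \<preceq> t" by blast
  moreover have "\<forall>s\<in>A. s \<preceq> x" if "t \<preceq> x"
    using \<open>\<forall>s\<in>A. s \<preceq> t\<close> that le_trans by blast
  ultimately show ?case using le_total[of x t] le_refl by blast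
qed simp

lemma lead_term_eqI: "t \<in> Poly_Mapping.keys p \<Longrightarrow> (\<And>s. s \<in> Poly_Mapping.keys p \<Longrightarrow> s \<preceq> t) \<Longrightarrow> lead_term \<sigma> p = t"
  unfolding lead_term_def by (rule the_equality) (auto intro: le_antisym)

lemma
  assumes "p \<noteq> 0"
  shows lead_term_in_keys: "lead_term \<sigma> p \<in> Poly_Mapping.keys p"
    and le_lead_term: "s \<in> Poly_Mapping.keys p \<Longrightarrow> s \<preceq> lead_term \<sigma> p"
proof -
  obtain t where "t \<in> Poly_Mapping.keys p" "\<forall>s\<in>Poly_Mapping.keys p. s \<preceq> t"
    using ex_max[of "Poly_Mapping.keys p"] assms by auto
  then show "lead_term \<sigma> p \<in> Poly_Mapping.keys p"
    "s \<in> Poly_Mapping.keys p \<Longrightarrow> s \<preceq> lead_term \<sigma> p"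
    using lead_term_eqI[of t p] by blast+
qed

end

section \<open>Order ideals\<close>

locale term_order_ideal = term_order \<sigma> for \<sigma> :: "('x::finite) trm rel" +
  fixes \<O> :: "'x trm set"
  assumes order_ideal: "order_ideal \<O>"
begin

lemma finite_O [simp]: "finite \<O>"
  using order_ideal by (simp add: order_ideal_def)

lemma divisor_in_O: "s + t \<in> \<O> \<Longrightarrow> t \<in> \<O>"
  using order_ideal unfolding order_ideal_def tdvd_def by (metis add.commute)

lemma zero_in_O [simp]: "0 \<in> \<O>"
  using order_ideal divisor_in_O[of _ 0] by (auto simp: order_ideal_def)

lemma borderE:
  assumes "b \<in> border \<O>"
  obtains k t where "b = Poly_Mapping.single k 1 + t" "t \<in> \<O>" "b \<notin> \<O>"
  using assms by (auto simp: border_def)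

lemma borderI: "t \<in> \<O> \<Longrightarrow> Poly_Mapping.single k 1 + t \<notin> \<O> \<Longrightarrow> Poly_Mapping.single k 1 + t \<in> border \<O>"
  by (auto simp: border_def)

lemma border_disjoint: "b \<in> border \<O> \<Longrightarrow> b \<notin> \<O>"
  by (simp add: border_def)

lemma finite_border: "finite (border \<O>)"
proof -
  have "border \<O> \<subseteq> (\<lambda>(k, t). Poly_Mapping.single k 1 + t) ` (UNIV \<times> \<O>)"
    by (auto simp: border_def)
  then show ?thesis by (rule finite_subset) auto
qed

text \<open>
  Dividing a minimal term outside \<open>\<O>\<close> by any of its indeterminates leads into \<open>\<O>\<close>.
\<close>

lemma corner_in_border:
  assumes "b \<in> corners \<O>"
  shows "b \<in> border \<O>"
proof -
  have b: "b \<notin> \<O>" using assms by (simp add: corners_def)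
  then have "b \<noteq> 0" by auto
  then obtain k where "k \<in> Poly_Mapping.keys b" using keys_eq_empty by blast
  then have k: "b = Poly_Mapping.single k 1 + (b - Poly_Mapping.single k 1)" by (rule trm_split)
  have "b - Poly_Mapping.single k 1 \<in> \<O>"
  proof (rule ccontr)
    assume "b - Poly_Mapping.single k 1 \<notin> \<O>"
    moreover have "tdvd (b - Poly_Mapping.single k 1) b"
      unfolding tdvd_def using k by (metis add.commute)
    ultimately have "b - Poly_Mapping.single k 1 = b" using assms by (simp add: corners_def)
    with k have "Poly_Mapping.single k (1::nat) = 0" by (metis add_cancel_left_left)
    then show False by (metis lookup_single_eq lookup_zero one_neq_zero)
  qed
  then show ?thesis using borderI b k by metis
qed

lemma finite_corners: "finite (corners \<O>)"
  using finite_subset[OF _ finite_border] corner_in_border by blast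

lemma corner_divides:
  assumes "t \<notin> \<O>"
  shows "\<exists>b\<in>corners \<O>. tdvd b t"
  using wf_lt assms
proof (induction t rule: wf_induct_rule)
  case (less t)
  show ?case
  proof (cases "t \<in> corners \<O>")
    case True
    then show ?thesis by (intro bexI[of _ t]) (auto simp: tdvd_iff)
  next
    case False
    then obtain s where s: "s \<notin> \<O>" "tdvd s t" "s \<noteq> t" using less.prems by (auto simp: corners_def)
    then obtain b where "b \<in> corners \<O>" "tdvd b s"
      using less.IH[of s] tdvd_imp_le by blast
    then show ?thesis using s(2) by (auto simp: tdvd_iff intro: order_trans)
  qed
qed

lemma corner_tdvd_corner: "b \<in> corners \<O> \<Longrightarrow> b' \<in> corners \<O> \<Longrightarrow> tdvd b b' \<Longrightarrow> b = b'"
  by (auto simp: corners_def)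

lemma corner_not_tdvd_O: "b \<in> corners \<O> \<Longrightarrow> t \<in> \<O> \<Longrightarrow> \<not> tdvd b t"
  using order_ideal by (auto simp: corners_def order_ideal_def)

end

section \<open>Normal forms modulo an ideal\<close>

locale ideal_with_complement = term_order_ideal +
  fixes I :: "('a::finite, 'k::field) mpoly set"
  assumes ideal_I: "ideal I P_ring" and complement: "complement_of_lead_terms \<sigma> I = \<O>"
begin

lemma lead_term_notin_O: "f \<in> I \<Longrightarrow> f \<noteq> 0 \<Longrightarrow> lead_term \<sigma> f \<notin> \<O>"
  using complement by (auto simp: complement_of_lead_terms_def)

lemma ex_lead_term: "t \<notin> \<O> \<Longrightarrow> \<exists>f\<in>I. f \<noteq> 0 \<and> lead_term \<sigma> f = t"
  using complement by (auto simp: complement_of_lead_terms_def)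

lemma in_I_keys_O: "f \<in> I \<Longrightarrow> Poly_Mapping.keys f \<subseteq> \<O> \<Longrightarrow> f = 0"
  using lead_term_notin_O lead_term_in_keys by blast

text \<open>
  Division with remainder: a term outside \<open>\<O>\<close> is the lead term of some \<open>f \<in> I\<close>; subtracting the
  monic multiple of \<open>f\<close> leaves smaller terms, to which induction along \<open>\<sigma>\<close> applies.
\<close>

lemma reduce_term: "\<exists>r. Poly_Mapping.keys r \<subseteq> \<O> \<and> Term t - r \<in> I \<and> (\<forall>s\<in>Poly_Mapping.keys r. s \<preceq> t)"
  using wf_lt
proof (induction t rule: wf_induct_rule)
  case (less t)
  show ?case
  proof (cases "t \<in> \<O>")
    case True
    then show ?thesis using ideal_P_ringD(1)[OF ideal_I] by (intro exI[of _ "Term t"]) (auto simp: Term_def)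
  next
    case False
    then obtain f where f: "f \<in> I" "f \<noteq> 0" "lead_term \<sigma> f = t" using ex_lead_term by blast
    define c where "c = Poly_Mapping.lookup f t"
    have "c \<noteq> 0" using lead_term_in_keys[OF f(2)] f(3) by (simp add: c_def in_keys_iff)
    define g where "g = Const (1 / c) * f"
    have g: "g \<in> I" "Poly_Mapping.lookup g t = 1" "Poly_Mapping.keys g = Poly_Mapping.keys f"
      using ideal_P_ringD(3)[OF ideal_I f(1)] \<open>c \<noteq> 0\<close>
      by (auto simp: g_def c_def in_keys_iff)
    have below: "s \<prec> t" if "s \<in> Poly_Mapping.keys g - {t}" for s
      using le_lead_term[OF f(2)] f(3) g(3) that by blast
    then have "\<forall>s\<in>Poly_Mapping.keys g - {t}. \<exists>r. Poly_Mapping.keys r \<subseteq> \<O> \<and> Term s - r \<in> I \<and>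
        (\<forall>u\<in>Poly_Mapping.keys r. u \<preceq> s)"
      using less.IH by blast
    then obtain r where r: "\<And>s. s \<in> Poly_Mapping.keys g - {t} \<Longrightarrow> Poly_Mapping.keys (r s) \<subseteq> \<O>"
      "\<And>s. s \<in> Poly_Mapping.keys g - {t} \<Longrightarrow> Term s - r s \<in> I"
      "\<And>s u. s \<in> Poly_Mapping.keys g - {t} \<Longrightarrow> u \<in> Poly_Mapping.keys (r s) \<Longrightarrow> u \<preceq> s"
      by metis
    define R where "R = - (\<Sum>s\<in>Poly_Mapping.keys g - {t}. Const (Poly_Mapping.lookup g s) * r s)"
    have keysR: "\<exists>s\<in>Poly_Mapping.keys g - {t}. u \<in> Poly_Mapping.keys (r s)" if "u \<in> Poly_Mapping.keys R" for u
    proof (rule ccontr)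
      assume "\<not> ?thesis"
      then have "Poly_Mapping.lookup R u = 0" by (simp add: R_def lookup_sum)
      with that show False by (simp add: in_keys_iff)
    qed
    have "t \<in> Poly_Mapping.keys g" using g(2) by (simp add: in_keys_iff)
    then have eq: "g = Term t + (\<Sum>s\<in>Poly_Mapping.keys g - {t}. Const (Poly_Mapping.lookup g s) * Term s)"
      using mpoly_expansion[of g] g(2) by (simp add: sum.remove[of "Poly_Mapping.keys g" t])
    have "Term t = g - (\<Sum>s\<in>Poly_Mapping.keys g - {t}. Const (Poly_Mapping.lookup g s) * Term s)"
      by (simp only: eq_diff_eq eq[symmetric])
    then have "Term t - R = g - (\<Sum>s\<in>Poly_Mapping.keys g - {t}. Const (Poly_Mapping.lookup g s) * (Term s - r s))"
      by (simp add: R_def right_diff_distrib sum_subtractf)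
    also have "\<dots> \<in> I"
      by (intro ideal_P_ringD(5)[OF ideal_I] g(1) ideal_P_sum[OF ideal_I] ideal_P_ringD(3)[OF ideal_I] r(2))
    finally have "Term t - R \<in> I" .
    moreover have "Poly_Mapping.keys R \<subseteq> \<O>" using keysR r(1) by blast
    moreover have "s \<preceq> t" if "s \<in> Poly_Mapping.keys R" for s
      using keysR[OF that] r(3) below le_trans by blast
    ultimately show ?thesis by blast
  qed
qed

lemma ex_normal_form: "\<exists>r. Poly_Mapping.keys r \<subseteq> \<O> \<and> p - r \<in> I"
proof (induction p rule: mpoly_linear_induct)
  case zero
  then show ?case using ideal_P_ringD(1)[OF ideal_I] by (intro exI[of _ 0]) simp
next
  case (add a m p)
  then obtain r r' where r: "Poly_Mapping.keys r \<subseteq> \<O>" "p - r \<in> I"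
    "Poly_Mapping.keys r' \<subseteq> \<O>" "Term m - r' \<in> I" using reduce_term by metis
  have "Poly_Mapping.keys (Const a * r' + r) \<subseteq> \<O>"
    using r(1,3) by (intro keys_subset_intros)
  moreover have "Const a * Term m + p - (Const a * r' + r) = Const a * (Term m - r') + (p - r)"
    by (simp add: algebra_simps)
  ultimately show ?case using r(2,4) ideal_P_ringD[OF ideal_I] by metis
qed

definition nf :: "('a, 'k) mpoly \<Rightarrow> ('a, 'k) mpoly"
  where "nf p = (SOME r. Poly_Mapping.keys r \<subseteq> \<O> \<and> p - r \<in> I)"

lemma keys_nf: "Poly_Mapping.keys (nf p) \<subseteq> \<O>" and diff_nf: "p - nf p \<in> I"
  using someI_ex[OF ex_normal_form[of p]] by (simp_all add: nf_def)

lemma nf_eqI: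
  assumes "Poly_Mapping.keys r \<subseteq> \<O>" "p - r \<in> I"
  shows "nf p = r"
proof -
  have "(p - r) - (p - nf p) \<in> I" using assms(2) diff_nf ideal_P_ringD(5)[OF ideal_I] by blast
  then have "nf p - r \<in> I" by (simp add: algebra_simps)
  moreover have "Poly_Mapping.keys (nf p - r) \<subseteq> \<O>"
    using keys_nf[of p] assms(1) by (intro keys_subset_intros)
  ultimately show ?thesis using in_I_keys_O by fastforce
qed

lemma keys_nf_Term: "s \<in> Poly_Mapping.keys (nf (Term t)) \<Longrightarrow> s \<preceq> t"
  using reduce_term[of t] nf_eqI by metis

lemma one_notin_I: "1 \<notin> I"
proof
  assume "1 \<in> I"
  moreover have "lead_term \<sigma> (1 :: ('a, 'k) mpoly) = 0" by (rule lead_term_eqI) auto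
  ultimately show False using lead_term_notin_O[of 1] by simp
qed

end

text \<open>
  Gaussian elimination of one coordinate: the vectors with index other than \<open>p\<close> are cleared at \<open>x\<close> with
  the help of the vector with index \<open>p\<close>.
\<close>

lemma linear_dependence:
  fixes v :: "'a \<Rightarrow> 'b \<Rightarrow> 'k::field"
  assumes "finite B" "finite A" "card B < card A"
  shows "\<exists>c. (\<exists>a\<in>A. c a \<noteq> 0) \<and> (\<forall>x\<in>B. (\<Sum>a\<in>A. c a * v a x) = 0)"
  using assms
proof (induction B arbitrary: A v rule: finite_induct)
  case empty
  then have "A \<noteq> {}" by auto
  then show ?case by (intro exI[of _ "\<lambda>_. 1"]) auto
next
  case (insert x B)
  show ?case
  proof (cases "\<exists>p\<in>A. v p x \<noteq> 0")
    case False
    then show ?thesis using insert.IH[of A v] insert.prems insert.hyps by auto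
  next
    case True
    then obtain p where p: "p \<in> A" "v p x \<noteq> 0" by blast
    define w where "w a y = v a y - v a x / v p x * v p y" for a y
    have "card B < card (A - {p})" using insert.prems insert.hyps p(1) by simp
    then obtain c where c: "\<exists>a\<in>A - {p}. c a \<noteq> 0" "\<forall>y\<in>B. (\<Sum>a\<in>A - {p}. c a * w a y) = 0"
      using insert.IH[of "A - {p}" w] insert.prems(1) by blast
    define d where "d a = (if a = p then - (\<Sum>a\<in>A - {p}. c a * (v a x / v p x)) else c a)" for a
    have "(\<Sum>a\<in>A. d a * v a y) = (\<Sum>a\<in>A - {p}. c a * w a y)" for y
    proof -
      have "(\<Sum>a\<in>A. d a * v a y) = d p * v p y + (\<Sum>a\<in>A - {p}. d a * v a y)"
        using p(1) insert.prems by (simp add: sum.remove)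
      also have "(\<Sum>a\<in>A - {p}. d a * v a y) = (\<Sum>a\<in>A - {p}. c a * v a y)"
        by (rule sum.cong) (auto simp: d_def)
      finally show ?thesis
        by (simp add: w_def d_def sum_distrib_right right_diff_distrib sum_subtractf mult.assoc)
    qed
    moreover have "w a x = 0" for a using p(2) by (simp add: w_def)
    moreover have "\<exists>a\<in>A. d a \<noteq> 0" using c(1) by (auto simp: d_def)
    ultimately show ?thesis using c(2) by (intro exI[of _ d]) auto
  qed
qed

context ideal_with_complement
begin

text \<open>
  The normal forms of the powers \<open>1, f, f\<^sup>2, \<dots>\<close> are linearly dependent, which gives a polynomial
  relation of \<open>f\<close> modulo \<open>I\<close>. If \<open>f\<close> is not in \<open>\<pp>\<close>, factors \<open>f\<close> can be cancelled from it until
  its constant coefficient is a nonzero scalar, so an ideal that contains \<open>\<pp>\<close> and \<open>f\<close> is the whole ring.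
\<close>

lemma prime_maximal:
  assumes "primeideal \<pp> P_ring" "I \<subseteq> \<pp>"
  shows "maximalideal \<pp> P_ring"
proof (rule maximalidealI)
  interpret primeideal \<pp> P_ring by fact
  show idp: "ideal \<pp> P_ring" by (rule is_ideal)
  have "\<pp> \<noteq> UNIV" using I_notcarr by simp
  then show "carrier P_ring \<noteq> \<pp>" by auto
  have prime: "q \<in> \<pp>" if "p * q \<in> \<pp>" "p \<notin> \<pp>" for p q
    using I_prime[of p q] that by auto
  fix J assume J: "ideal J P_ring" "\<pp> \<subseteq> J" "J \<subseteq> carrier P_ring"
  show "J = \<pp> \<or> J = carrier P_ring"
  proof (cases "J = \<pp>")
    case False
    then obtain f where f: "f \<in> J" "f \<notin> \<pp>" using J by blast
    have unit: "J = UNIV" if "Const c \<in> J" "c \<noteq> 0" for c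
    proof -
      have "p \<in> J" for p
        using ideal_P_ringD(3)[OF J(1) that(1), of "p * Const (1 / c)"] that(2)
        by (simp add: mult.assoc Const_mult[symmetric])
      then show ?thesis by blast
    qed
    \<comment> \<open>Induction on the degree: a relation without constant coefficient is divisible by \<open>f\<close>.\<close>
    have relation: "J = UNIV" if "(\<Sum>a\<le>N. Const (c a) * f ^ a) \<in> \<pp>" "\<exists>a\<le>N. c a \<noteq> 0" for N c
      using that
    proof (induction N arbitrary: c)
      case 0
      then show ?case using unit[of "c 0"] J(2) by auto
    next
      case (Suc N)
      define S where "S = (\<Sum>a\<le>N. Const (c (Suc a)) * f ^ a)"
      have eq: "(\<Sum>a\<le>Suc N. Const (c a) * f ^ a) = Const (c 0) + f * S"
        unfolding sum.atMost_Suc_shift S_def by (simp add: sum_distrib_left mult_ac)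
      show ?case
      proof (cases "c 0 = 0")
        case True
        then have "f * S \<in> \<pp>" using Suc.prems(1) eq by simp
        then have "S \<in> \<pp>" using prime f(2) by blast
        moreover have "\<exists>a\<le>N. c (Suc a) \<noteq> 0"
          using Suc.prems(2) True by (metis Suc_le_mono not0_implies_Suc)
        ultimately show ?thesis using Suc.IH[of "\<lambda>a. c (Suc a)"] by (simp add: S_def)
      next
        case False
        have "Const (c 0) + f * S \<in> J" using Suc.prems(1) eq J(2) by auto
        moreover have "f * S \<in> J" using ideal_P_ringD(3)[OF J(1) f(1), of S] by (simp add: mult.commute)
        ultimately have "Const (c 0) \<in> J" using ideal_P_ringD(5)[OF J(1)] by fastforce
        then show ?thesis using unit False by blast
      qed
    qed
    obtain c where c: "\<exists>a\<le>card \<O>. c a \<noteq> 0"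
      "\<And>x. x \<in> \<O> \<Longrightarrow> (\<Sum>a\<le>card \<O>. c a * Poly_Mapping.lookup (nf (f ^ a)) x) = 0"
      using linear_dependence[of \<O> "{..card \<O>}" "\<lambda>a. Poly_Mapping.lookup (nf (f ^ a))"] by auto
    have "(\<Sum>a\<le>card \<O>. Const (c a) * nf (f ^ a)) = 0"
    proof (rule poly_mapping_eqI)
      fix x
      show "Poly_Mapping.lookup (\<Sum>a\<le>card \<O>. Const (c a) * nf (f ^ a)) x = Poly_Mapping.lookup 0 x"
      proof (cases "x \<in> \<O>")
        case False
        then have "x \<notin> Poly_Mapping.keys (nf (f ^ a))" for a using keys_nf by blast
        then show ?thesis by (simp add: lookup_sum)
      qed (simp add: lookup_sum c(2))
    qed
    then have "(\<Sum>a\<le>card \<O>. Const (c a) * f ^ a) = (\<Sum>a\<le>card \<O>. Const (c a) * (f ^ a - nf (f ^ a)))"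
      by (simp add: right_diff_distrib sum_subtractf)
    also have "\<dots> \<in> I"
      by (intro ideal_P_sum[OF ideal_I] ideal_P_ringD(3)[OF ideal_I] diff_nf)
    finally have "(\<Sum>a\<le>card \<O>. Const (c a) * f ^ a) \<in> \<pp>" using assms(2) by blast
    then show ?thesis using relation[OF _ c(1)] by simp
  qed simp
qed

lemma zero_dimensional_I: "zero_dimensional P_ring I"
  using ideal_I prime_maximal one_notin_I unfolding zero_dimensional_def by auto

end


section \<open>Linear extension of maps on terms\<close>

definition linear_extension :: "('v trm \<Rightarrow> ('w, 'k::comm_ring_1) mpoly) \<Rightarrow> ('v, 'k) mpoly \<Rightarrow> ('w, 'k) mpoly"
  where "linear_extension r p = (\<Sum>m\<in>Poly_Mapping.keys p. Const (Poly_Mapping.lookup p m) * r m)"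

lemma linear_extension_superset:
  "finite A \<Longrightarrow> Poly_Mapping.keys p \<subseteq> A \<Longrightarrow> linear_extension r p = (\<Sum>m\<in>A. Const (Poly_Mapping.lookup p m) * r m)"
  unfolding linear_extension_def by (rule sum.mono_neutral_left) auto

lemma linear_extension_0 [simp]: "linear_extension r 0 = 0"
  by (simp add: linear_extension_def)

lemma linear_extension_add [simp]: "linear_extension r (p + q) = linear_extension r p + linear_extension r q"
proof -
  let ?A = "Poly_Mapping.keys p \<union> Poly_Mapping.keys q"
  show ?thesis
    using keys_add[of p q]
    by (simp add: linear_extension_superset[where A = ?A] lookup_add Const_add distrib_right sum.distrib)
qed

lemma linear_extension_Const_mult [simp]: "linear_extension r (Const c * p) = Const c * linear_extension r p"
  using keys_Const_mult_subset[OF order_refl, of c p]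
  by (simp add: linear_extension_superset[where A = "Poly_Mapping.keys p"] Const_mult sum_distrib_left mult.assoc)

lemma linear_extension_Term [simp]: "linear_extension r (Term m) = r m"
  by (simp add: linear_extension_superset[where A = "{m}"] Term_def)

lemma linear_extension_minus [simp]: "linear_extension r (- p) = - linear_extension r p"
  using linear_extension_add[of r p "- p"] by (simp del: linear_extension_add add: eq_neg_iff_add_eq_0 add.commute)

lemma linear_extension_diff [simp]: "linear_extension r (p - q) = linear_extension r p - linear_extension r q"
  using linear_extension_add[of r p "- q"] by simp

lemma linear_extension_sum [simp]: "linear_extension r (sum f A) = (\<Sum>x\<in>A. linear_extension r (f x))"
  by (induction A rule: infinite_finite_induct) simp_all

section \<open>Points of the border basis scheme\<close>

lemma set_add_poly_ring: "A <+>\<^bsub>poly_ring V\<^esub> B = {a + b | a b. a \<in> A \<and> b \<in> B}"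
  by (auto simp: set_add_def set_mult_def)

lemma subst_id_cong:
  fixes f :: "('v, 'k::comm_ring_1) mpoly" and a b :: "'v \<Rightarrow> 'k"
  assumes "f \<in> carrier (poly_ring V)" "\<And>v. v \<in> V \<Longrightarrow> a v = b v"
  shows "subst id a f = subst id b f"
  using assms(1)
proof (induction f rule: poly_ring_induct)
  case (Var v)
  then show ?case by (simp only: id_hom.subst_Var assms(2))
qed (simp_all only: id_hom.subst_Const id_hom.subst_add id_hom.subst_mult)

lemma ideal_vanishing: "ideal {f \<in> carrier (poly_ring V). subst id a f = 0} (poly_ring V)"
  by (auto simp: ideal_poly_ring_iff intro: poly_ring_closed)

context term_order_ideal
begin

text \<open>
  The ideal of the closed subscheme of the border basis scheme on which \<open>c\<^sub>i\<^sub>j = 0\<close> whenever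
  \<open>t\<^sub>i\<close> is not smaller than \<open>b\<^sub>j\<close>; intersecting it with \<open>K[S]\<close> gives \<open>gb_scheme_ideal\<close>.
\<close>

abbreviation J :: "('x cidx, 'k::field) mpoly set"
  where "J \<equiv> L_ideal \<O> \<sigma> <+>\<^bsub>Kc \<O>\<^esub> border_scheme_ideal \<O>"

definition mulmat :: "('x cidx \<Rightarrow> 'k::field) \<Rightarrow> 'x \<Rightarrow> 'x trm \<Rightarrow> 'x trm \<Rightarrow> 'k"
  where "mulmat a k s t =
    (let xt = Poly_Mapping.single k 1 + t in
     if xt \<in> \<O> then (if s = xt then 1 else 0) else a (s, xt))"

definition commuting :: "('x cidx \<Rightarrow> 'k::field) \<Rightarrow> bool"
  where "commuting a \<longleftrightarrow> (\<forall>k l. \<forall>s\<in>\<O>. \<forall>t\<in>\<O>.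
    (\<Sum>u\<in>\<O>. mulmat a k s u * mulmat a l u t) = (\<Sum>u\<in>\<O>. mulmat a l s u * mulmat a k u t))"

definition order_compatible :: "('x cidx \<Rightarrow> 'k::field) \<Rightarrow> bool"
  where "order_compatible a \<longleftrightarrow> (\<forall>c\<in>c_indices \<O> - S_full \<O> \<sigma>. a c = 0)"

lemma S_full_iff: "(t, b) \<in> S_full \<O> \<sigma> \<longleftrightarrow> t \<in> \<O> \<and> b \<in> border \<O> \<and> t \<preceq> b"
  using border_disjoint by (auto simp: S_full_def c_indices_def)

lemma S_corner_iff: "(t, b) \<in> S_corner \<O> \<sigma> \<longleftrightarrow> t \<in> \<O> \<and> b \<in> corners \<O> \<and> t \<preceq> b"
  using corner_in_border by (auto simp: S_corner_def S_full_iff)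

lemma S_corner_subset: "S_corner \<O> \<sigma> \<subseteq> c_indices \<O>"
  by (auto simp: S_corner_def S_full_def)

lemma subst_mult_matrix: "subst id a (mult_matrix \<O> k s t) = mulmat a k s t"
  by (simp add: mult_matrix_def mulmat_def Let_def)

lemma mult_matrix_in_Kc:
  "s \<in> \<O> \<Longrightarrow> t \<in> \<O> \<Longrightarrow> mult_matrix \<O> k s t \<in> carrier (Kc \<O>)"
  using borderI[of t k] by (auto simp: mult_matrix_def Let_def c_indices_def intro: poly_ring_closed)

abbreviation commutators :: "('x cidx, 'k::field) mpoly set"
  where "commutators \<equiv> {(\<Sum>u\<in>\<O>. mult_matrix \<O> k s u * mult_matrix \<O> l u t) -
     (\<Sum>u\<in>\<O>. mult_matrix \<O> l s u * mult_matrix \<O> k u t) | k l s t. s \<in> \<O> \<and> t \<in> \<O>}"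

lemma commutators_subset: "commutators \<subseteq> carrier (Kc \<O>)"
  by (auto intro!: poly_ring_closed sum_in_poly_ring mult_matrix_in_Kc)

lemma Var_indices_subset: "Var ` (c_indices \<O> - S_full \<O> \<sigma>) \<subseteq> carrier (Kc \<O>)"
  by (auto intro: poly_ring_closed)

lemma ideal_L: "ideal (L_ideal \<O> \<sigma>) (Kc \<O>)"
  unfolding L_ideal_def by (rule ring.genideal_ideal[OF ring_poly_ring Var_indices_subset])

lemma ideal_B: "ideal (border_scheme_ideal \<O>) (Kc \<O>)"
  unfolding border_scheme_ideal_def by (rule ring.genideal_ideal[OF ring_poly_ring commutators_subset])

lemma ideal_J: "ideal J (Kc \<O>)"
  by (rule ring.add_ideals[OF ring_poly_ring ideal_L ideal_B])

lemma L_subset_J: "f \<in> L_ideal \<O> \<sigma> \<Longrightarrow> f \<in> J"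
  unfolding set_add_poly_ring using ideal_poly_ringD(2)[OF ideal_B] by force

lemma B_subset_J: "f \<in> border_scheme_ideal \<O> \<Longrightarrow> f \<in> J"
  unfolding set_add_poly_ring using ideal_poly_ringD(2)[OF ideal_L] by force

lemma Var_in_J: "c \<in> c_indices \<O> - S_full \<O> \<sigma> \<Longrightarrow> Var c \<in> J"
  by (rule L_subset_J, unfold L_ideal_def, rule subsetD[OF ring.genideal_self[OF ring_poly_ring Var_indices_subset]]) (rule imageI)

lemma commutator_in_J: "f \<in> commutators \<Longrightarrow> f \<in> J"
  by (rule B_subset_J, unfold border_scheme_ideal_def)
    (rule subsetD[OF ring.genideal_self[OF ring_poly_ring commutators_subset]])

lemma vanishing_on_J_iff: "(\<forall>f\<in>J. subst id a f = 0) \<longleftrightarrow> order_compatible a \<and> commuting a"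
proof
  assume *: "\<forall>f\<in>J. subst id a f = 0"
  have "order_compatible a" unfolding order_compatible_def using * Var_in_J by force
  moreover have "(\<Sum>u\<in>\<O>. mulmat a k s u * mulmat a l u t) = (\<Sum>u\<in>\<O>. mulmat a l s u * mulmat a k u t)"
    if "s \<in> \<O>" "t \<in> \<O>" for k l s t
  proof -
    have "(\<Sum>u\<in>\<O>. mult_matrix \<O> k s u * mult_matrix \<O> l u t) -
      (\<Sum>u\<in>\<O>. mult_matrix \<O> l s u * mult_matrix \<O> k u t) \<in> J"
      using that by (intro commutator_in_J) blast
    from *[rule_format, OF this] show ?thesis by (simp add: subst_mult_matrix)
  qed
  ultimately show "order_compatible a \<and> commuting a" unfolding commuting_def by blast
next
  assume *: "order_compatible a \<and> commuting a"
  let ?Z = "{f \<in> carrier (Kc \<O>). subst id a f = 0}"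
  have "L_ideal \<O> \<sigma> \<subseteq> ?Z"
    unfolding L_ideal_def
    by (rule ring.genideal_minimal[OF ring_poly_ring ideal_vanishing])
      (use * in \<open>auto simp: order_compatible_def intro: poly_ring_closed\<close>)
  moreover have "border_scheme_ideal \<O> \<subseteq> ?Z"
    unfolding border_scheme_ideal_def
    by (rule ring.genideal_minimal[OF ring_poly_ring ideal_vanishing])
      (use * in \<open>auto simp: commuting_def subst_mult_matrix
        intro!: poly_ring_closed sum_in_poly_ring mult_matrix_in_Kc\<close>)
  ultimately show "\<forall>f\<in>J. subst id a f = 0"
    unfolding set_add_poly_ring by fastforce
qed

section \<open>From commuting matrices to ideals\<close>

text \<open>
  Vectors indexed by \<open>\<O>\<close> are represented as polynomials supported on \<open>\<O>\<close>, so that the matrix of \<open>x\<^sub>k\<close>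
  becomes an operator on polynomials; coefficients outside \<open>\<O>\<close> are discarded.
\<close>

definition mult_op :: "('x cidx \<Rightarrow> 'k::field) \<Rightarrow> 'x \<Rightarrow> ('x, 'k) mpoly \<Rightarrow> ('x, 'k) mpoly"
  where "mult_op a k p = (\<Sum>t\<in>\<O>. \<Sum>s\<in>\<O>. Const (mulmat a k s t * Poly_Mapping.lookup p t) * Term s)"

lemma lookup_mult_op:
  "Poly_Mapping.lookup (mult_op a k p) s =
    (if s \<in> \<O> then \<Sum>t\<in>\<O>. mulmat a k s t * Poly_Mapping.lookup p t else 0)"
  by (simp add: mult_op_def lookup_sum lookup_Term sum.delta if_distrib[where f = "\<lambda>x. _ * x"] cong: if_cong)

lemma mult_op_add: "mult_op a k (p + q) = mult_op a k p + mult_op a k q"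
  by (rule poly_mapping_eqI) (simp add: lookup_mult_op lookup_add distrib_left sum.distrib)

lemma mult_op_Const_mult: "mult_op a k (Const c * p) = Const c * mult_op a k p"
  by (rule poly_mapping_eqI) (simp add: lookup_mult_op sum_distrib_left mult.left_commute)

lemma mult_op_0 [simp]: "mult_op a k 0 = 0"
  by (rule poly_mapping_eqI) (simp add: lookup_mult_op)

lemma mult_op_commute:
  assumes "commuting a"
  shows "mult_op a k (mult_op a l p) = mult_op a l (mult_op a k p)"
proof -
  have *: "(\<Sum>t\<in>\<O>. mulmat a k s t * (\<Sum>u\<in>\<O>. mulmat a l t u * Poly_Mapping.lookup p u)) =
      (\<Sum>u\<in>\<O>. (\<Sum>t\<in>\<O>. mulmat a k s t * mulmat a l t u) * Poly_Mapping.lookup p u)" for k l s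
    unfolding sum_distrib_left sum_distrib_right by (subst sum.swap) (simp add: mult.assoc)
  show ?thesis
  proof (rule poly_mapping_eqI)
    fix s
    have "(\<Sum>u\<in>\<O>. (\<Sum>t\<in>\<O>. mulmat a k s t * mulmat a l t u) * Poly_Mapping.lookup p u) =
      (\<Sum>u\<in>\<O>. (\<Sum>t\<in>\<O>. mulmat a l s t * mulmat a k t u) * Poly_Mapping.lookup p u)" if "s \<in> \<O>"
      by (rule sum.cong) (use assms that in \<open>auto simp: commuting_def\<close>)
    then show "Poly_Mapping.lookup (mult_op a k (mult_op a l p)) s = Poly_Mapping.lookup (mult_op a l (mult_op a k p)) s"
      by (simp add: lookup_mult_op *)
  qed
qed

lemma mult_op_Term:
  assumes "t \<in> \<O>"
  shows "mult_op a k (Term t) = (if Poly_Mapping.single k 1 + t \<in> \<O> then Term (Poly_Mapping.single k 1 + t)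
    else \<Sum>s\<in>\<O>. Const (a (s, Poly_Mapping.single k 1 + t)) * Term s)"
proof (rule poly_mapping_eqI)
  fix s
  have "(\<Sum>u\<in>\<O>. mulmat a k s u * Poly_Mapping.lookup (Term t) u) = mulmat a k s t"
    using assms by (simp add: lookup_Term sum.delta if_distrib[where f = "\<lambda>x. _ * x"] cong: if_cong)
  then show "Poly_Mapping.lookup (mult_op a k (Term t)) s = Poly_Mapping.lookup (if Poly_Mapping.single k 1 + t \<in> \<O> then Term (Poly_Mapping.single k 1 + t)
    else \<Sum>s\<in>\<O>. Const (a (s, Poly_Mapping.single k 1 + t)) * Term s) s"
    by (auto simp: lookup_mult_op mulmat_def Let_def lookup_Term lookup_sum sum.delta if_distrib[where f = "\<lambda>x. _ * x"] cong: if_cong)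
qed

lemma mulmat_le:
  assumes "order_compatible a" "mulmat a k s u \<noteq> 0" "s \<in> \<O>" "u \<in> \<O>"
  shows "s \<preceq> Poly_Mapping.single k 1 + u"
proof (cases "Poly_Mapping.single k 1 + u \<in> \<O>")
  case True
  then show ?thesis using assms(2) by (auto simp: mulmat_def split: if_splits)
next
  case False
  then have "a (s, Poly_Mapping.single k 1 + u) \<noteq> 0" using assms(2) by (simp add: mulmat_def)
  moreover have "(s, Poly_Mapping.single k 1 + u) \<in> c_indices \<O>"
    using borderI[OF assms(4) False] assms(3) by (simp add: c_indices_def)
  ultimately have "(s, Poly_Mapping.single k 1 + u) \<in> S_full \<O> \<sigma>"
    using assms(1) unfolding order_compatible_def by blast
  then show ?thesis by (simp add: S_full_def)
qed

text \<open>
  \<open>g\<^sub>b\<^sup>*\<close> specialized at \<open>a\<close> (see \<open>specialize_g_star\<close>), as an element of \<open>K[x]\<close> from the start. It depends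
  only on the values of \<open>a\<close> at \<open>(t, b)\<close> with \<open>t < b\<close>, and hence is the same for a rational point and for any
  of its extensions to \<open>c_indices \<O>\<close>.
\<close>

definition prebasis :: "('x cidx \<Rightarrow> 'k::field) \<Rightarrow> 'x trm \<Rightarrow> ('x, 'k) mpoly"
  where "prebasis a b = Term b - (\<Sum>t | t \<in> \<O> \<and> t \<prec> b. Const (a (t, b)) * Term t)"

lemma lookup_prebasis:
  "Poly_Mapping.lookup (prebasis a b) s = (if s = b then 1 else if s \<in> \<O> \<and> s \<preceq> b then - a (s, b) else 0)"
proof -
  have "finite {t. t \<in> \<O> \<and> t \<prec> b}" by (rule finite_subset[OF _ finite_O]) auto
  then show ?thesis
    by (auto simp: prebasis_def lookup_minus lookup_sum lookup_Term sum.delta if_distrib[where f = "\<lambda>x. _ * x"] cong: if_cong)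
qed

lemma keys_prebasis: "t \<in> Poly_Mapping.keys (prebasis a b) \<Longrightarrow> t = b \<or> t \<in> \<O> \<and> t \<preceq> b"
  by (auto simp: in_keys_iff lookup_prebasis split: if_splits)

lemma lead_term_prebasis [simp]: "lead_term \<sigma> (prebasis a b) = b"
  by (rule lead_term_eqI) (auto simp: in_keys_iff lookup_prebasis split: if_splits)

lemma prebasis_nonzero [simp]: "prebasis a b \<noteq> 0"
  using lookup_prebasis[of a b b] by auto

lemma prebasis_as_full_sum:
  assumes "order_compatible a" "b \<in> border \<O>"
  shows "prebasis a b = Term b - (\<Sum>t\<in>\<O>. Const (a (t, b)) * Term t)"
proof -
  have "a (t, b) = 0" if "t \<in> \<O>" "\<not> t \<prec> b" for t
    using assms that border_disjoint by (auto simp: order_compatible_def c_indices_def S_full_def)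
  then have "(\<Sum>t | t \<in> \<O> \<and> t \<prec> b. Const (a (t, b)) * Term t) = (\<Sum>t\<in>\<O>. Const (a (t, b)) * Term t)"
    by (intro sum.mono_neutral_left) auto
  then show ?thesis by (simp add: prebasis_def)
qed

end

lemma lookup_Term_mult: "Poly_Mapping.lookup (Term u * p) (u + m) = Poly_Mapping.lookup p m"
  for p :: "('v, 'k::comm_ring_1) mpoly"
proof (induction p rule: mpoly_linear_induct)
  case (add a n p)
  have "Term u * (Const a * Term n + p) = Const a * Term (u + n) + Term u * p"
    by (simp add: Term_add algebra_simps)
  then show ?case using add by (simp add: lookup_add lookup_Term)
qed simp

lemma keys_Term_mult: "Poly_Mapping.keys (Term u * p) = (\<lambda>m. u + m) ` Poly_Mapping.keys p"
  for p :: "('v, 'k::comm_ring_1) mpoly"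
proof
  have "Poly_Mapping.keys (Term u :: ('v, 'k) mpoly) \<subseteq> {u}" by (auto simp: Term_def)
  then show "Poly_Mapping.keys (Term u * p) \<subseteq> (\<lambda>m. u + m) ` Poly_Mapping.keys p"
    using keys_mult[of "Term u" p] by blast
qed (auto simp: in_keys_iff lookup_Term_mult)

lemma (in term_order) lead_term_Term_mult:
  assumes "p \<noteq> 0"
  shows "Term u * p \<noteq> 0" "lead_term \<sigma> (Term u * p) = u + lead_term \<sigma> p"
proof -
  show "lead_term \<sigma> (Term u * p) = u + lead_term \<sigma> p"
    by (rule lead_term_eqI)
      (use lead_term_in_keys[OF assms] le_lead_term[OF assms] add_left_le in \<open>auto simp: keys_Term_mult\<close>)
  show "Term u * p \<noteq> 0"
    using lead_term_in_keys[OF assms] keys_Term_mult[of u p] by force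
qed

context term_order_ideal
begin

abbreviation prebasis_ideal :: "('x cidx \<Rightarrow> 'k::field) \<Rightarrow> ('x, 'k) mpoly set"
  where "prebasis_ideal a \<equiv> Idl\<^bsub>P_ring\<^esub> (prebasis a ` corners \<O>)"

lemma ideal_prebasis_ideal: "ideal (prebasis_ideal a) P_ring"
  by (rule ring.genideal_ideal[OF ring_P_ring]) simp

lemma prebasis_in_ideal: "b \<in> corners \<O> \<Longrightarrow> prebasis a b \<in> prebasis_ideal a"
  using ring.genideal_self[OF ring_P_ring, of "prebasis a ` corners \<O>"] by auto

text \<open>
  \<open>N t\<close> is the result of applying the commuting operators to \<open>1\<close> as prescribed by the term \<open>t\<close>, and \<open>\<phi>\<close>
  is its linear extension. Compatibility with \<open>\<sigma>\<close> keeps \<open>N t\<close> below \<open>t\<close>, so the coefficient of a lead term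
  in \<open>\<O>\<close> cannot be cancelled by the images of the other terms.
\<close>

lemma prebasis_ideal_lead_term_notin_O:
  assumes "order_compatible a" "commuting a" "f \<in> prebasis_ideal a" "f \<noteq> 0"
  shows "lead_term \<sigma> f \<notin> \<O>"
proof
  assume lt: "lead_term \<sigma> f \<in> \<O>"
  obtain N :: "'x trm \<Rightarrow> ('x, 'a) mpoly" where
    N0: "N 0 = Term 0" and N: "\<And>k m. N (Poly_Mapping.single k 1 + m) = mult_op a k (N m)"
    using commuting_operators_act_on_terms[of "mult_op a" "Term 0"] mult_op_commute[OF assms(2)] by blast
  have N_O: "N t = Term t" if "t \<in> \<O>" for t
    using that
  proof (induction t rule: trm_induct)
    case (var_add k m)
    then have "m \<in> \<O>" using divisor_in_O by blast
    then show ?case using var_add unfolding N by (simp add: mult_op_Term)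
  qed (simp add: N0)
  have keys_N: "s \<in> \<O> \<and> s \<preceq> t" if "s \<in> Poly_Mapping.keys (N t)" for s t
    using that
  proof (induction t arbitrary: s rule: trm_induct)
    case zero
    then show ?case by (simp add: N0)
  next
    case (var_add k m)
    then have *: "s \<in> \<O>" "(\<Sum>t\<in>\<O>. mulmat a k s t * Poly_Mapping.lookup (N m) t) \<noteq> 0"
      unfolding N by (auto simp: in_keys_iff lookup_mult_op split: if_splits)
    then obtain u where u: "u \<in> \<O>" "mulmat a k s u * Poly_Mapping.lookup (N m) u \<noteq> 0"
      by (meson sum.not_neutral_contains_not_neutral)
    then have "u \<preceq> m" using var_add.IH[of u] by (auto simp: in_keys_iff)
    moreover have "s \<preceq> Poly_Mapping.single k 1 + u"
      using mulmat_le[OF assms(1)] u *(1) by auto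
    ultimately show ?case using *(1) add_left_le le_trans by blast
  qed
  define \<phi> where "\<phi> = linear_extension N"
  have \<phi>_Var: "\<phi> (Var k * p) = mult_op a k (\<phi> p)" for k p
  proof (induction p rule: mpoly_linear_induct)
    case (add c m p)
    have "Var k * (Const c * Term m + p) = Const c * Term (Poly_Mapping.single k 1 + m) + Var k * p"
      by (simp only: Term_add Term_single) (simp only: algebra_simps)
    then have "\<phi> (Var k * (Const c * Term m + p)) = Const c * mult_op a k (N m) + mult_op a k (\<phi> p)"
      using add by (simp only: \<phi>_def linear_extension_add linear_extension_Const_mult linear_extension_Term N)
    then show ?case by (simp add: \<phi>_def mult_op_add mult_op_Const_mult)
  qed (simp add: \<phi>_def)
  have "\<phi> (r * p) = 0" if "\<phi> p = 0" for r p
    using UNIV_I[of r] that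
    by (induction r arbitrary: p rule: P_ring_induct) (simp_all add: \<phi>_Var mult.assoc distrib_right, simp_all add: \<phi>_def)
  then have "ideal {p. \<phi> p = 0} P_ring"
    by (intro ideal_P_ringI) (auto simp: \<phi>_def)
  moreover have "\<phi> (prebasis a b) = 0" if "b \<in> corners \<O>" for b
  proof -
    have b: "b \<in> border \<O>" using that by (rule corner_in_border)
    then obtain k t where kt: "b = Poly_Mapping.single k 1 + t" "t \<in> \<O>" "b \<notin> \<O>" by (rule borderE)
    have "N b = (\<Sum>s\<in>\<O>. Const (a (s, b)) * Term s)"
      using kt by (simp add: N[unfolded One_nat_def] N_O mult_op_Term)
    then show ?thesis
      by (simp add: prebasis_as_full_sum[OF assms(1) b] \<phi>_def N_O)
  qed
  ultimately have "prebasis_ideal a \<subseteq> {p. \<phi> p = 0}"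
    by (intro ring.genideal_minimal[OF ring_P_ring]) auto
  then have "\<phi> f = 0" using assms(3) by blast
  then have "0 = Poly_Mapping.lookup (\<phi> f) (lead_term \<sigma> f)" by simp
  also have "\<dots> = (\<Sum>m\<in>Poly_Mapping.keys f. Poly_Mapping.lookup f m * Poly_Mapping.lookup (N m) (lead_term \<sigma> f))"
    by (simp add: \<phi>_def linear_extension_def lookup_sum)
  also have "\<dots> = (\<Sum>m\<in>{lead_term \<sigma> f}. Poly_Mapping.lookup f m * Poly_Mapping.lookup (N m) (lead_term \<sigma> f))"
  proof (rule sum.mono_neutral_right)
    show "\<forall>m\<in>Poly_Mapping.keys f - {lead_term \<sigma> f}. Poly_Mapping.lookup f m * Poly_Mapping.lookup (N m) (lead_term \<sigma> f) = 0"
    proof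
      fix m assume "m \<in> Poly_Mapping.keys f - {lead_term \<sigma> f}"
      then have "m \<preceq> lead_term \<sigma> f" "m \<noteq> lead_term \<sigma> f" using le_lead_term[OF assms(4)] by auto
      then have "lead_term \<sigma> f \<notin> Poly_Mapping.keys (N m)" using keys_N le_antisym by blast
      then show "Poly_Mapping.lookup f m * Poly_Mapping.lookup (N m) (lead_term \<sigma> f) = 0" by simp
    qed
  qed (use lead_term_in_keys[OF assms(4)] in auto)
  also have "\<dots> = Poly_Mapping.lookup f (lead_term \<sigma> f)"
    by (simp add: N_O[OF lt] lookup_Term)
  finally show False using lead_term_in_keys[OF assms(4)] by (simp add: in_keys_iff)
qed

lemma prebasis_ideal_complement:
  assumes "order_compatible a" "commuting a"
  shows "complement_of_lead_terms \<sigma> (prebasis_ideal a) = \<O>"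
proof -
  have "\<exists>f\<in>prebasis_ideal a. f \<noteq> 0 \<and> lead_term \<sigma> f = t" if t: "t \<notin> \<O>" for t
  proof -
    obtain b u where "b \<in> corners \<O>" "t = b + u" using corner_divides[OF t] by (auto simp: tdvd_def)
    then show ?thesis
      using lead_term_Term_mult[OF prebasis_nonzero, of u a b] ideal_P_ringD(3)[OF ideal_prebasis_ideal prebasis_in_ideal]
      by (intro bexI[of _ "Term u * prebasis a b"]) (auto simp: add.commute)
  qed
  then show ?thesis
    using prebasis_ideal_lead_term_notin_O[OF assms] by (auto simp: complement_of_lead_terms_def)
qed

lemma prebasis_reduced_groebner:
  assumes "order_compatible a" "commuting a"
  shows "reduced_groebner_basis \<sigma> (prebasis_ideal a) (prebasis a ` corners \<O>)"
proof -
  have "\<exists>g\<in>prebasis a ` corners \<O>. tdvd (lead_term \<sigma> g) (lead_term \<sigma> f)"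
    if "f \<in> prebasis_ideal a - {0}" for f
    using corner_divides[OF prebasis_ideal_lead_term_notin_O[OF assms, of f]] that by auto
  moreover have "\<not> tdvd b' t"
    if "b \<in> corners \<O>" "b' \<in> corners \<O>" "t \<in> Poly_Mapping.keys (prebasis a b)" "prebasis a b' \<noteq> prebasis a b" for b b' t
    using keys_prebasis[OF that(3)] corner_tdvd_corner[OF that(2,1)] corner_not_tdvd_O[OF that(2)] that(4) by blast
  ultimately show ?thesis
    unfolding reduced_groebner_basis_def groebner_basis_def
    using prebasis_in_ideal finite_corners by (auto simp: lookup_prebasis)
qed

end


section \<open>Elimination of the coefficients at non-corners\<close>

context term_order_ideal
begin

lemma KS_subset_Kc: "p \<in> carrier (KS \<O> \<sigma>) \<Longrightarrow> p \<in> carrier (Kc \<O>)"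
  using poly_ring_mono[OF S_corner_subset] .

text \<open>
  Membership in the subring \<open>K[S] + J\<close> of \<open>K[c]\<close>, which \<open>Kc_reduces_to_KS\<close> shows to be the whole ring.
\<close>

definition reducible :: "('x cidx, 'k::field) mpoly \<Rightarrow> bool"
  where "reducible f \<longleftrightarrow> f \<in> carrier (Kc \<O>) \<and> (\<exists>\<rho>\<in>carrier (KS \<O> \<sigma>). f - \<rho> \<in> J)"

lemma reducible_KS: "f \<in> carrier (KS \<O> \<sigma>) \<Longrightarrow> reducible f"
  unfolding reducible_def by (intro conjI bexI[of _ f]) (simp_all add: KS_subset_Kc ideal_poly_ringD(2)[OF ideal_J])

lemma reducible_J: "f \<in> J \<Longrightarrow> reducible f"
  unfolding reducible_def using ideal_poly_ringD(1)[OF ideal_J] by (intro conjI bexI[of _ 0]) auto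

lemma reducible_add:
  assumes "reducible f" "reducible g"
  shows "reducible (f + g)"
proof -
  obtain \<rho> \<rho>' where \<rho>: "\<rho> \<in> carrier (KS \<O> \<sigma>)" "f - \<rho> \<in> J" "\<rho>' \<in> carrier (KS \<O> \<sigma>)" "g - \<rho>' \<in> J"
    using assms unfolding reducible_def by blast
  have "(f + g) - (\<rho> + \<rho>') = (f - \<rho>) + (g - \<rho>')" by simp
  then have "(f + g) - (\<rho> + \<rho>') \<in> J" using ideal_poly_ringD(3)[OF ideal_J \<rho>(2,4)] by (simp only:)
  then show ?thesis
    using assms \<rho> unfolding reducible_def by (blast intro: poly_ring_closed)
qed

lemma reducible_mult:
  assumes "reducible f" "reducible g"
  shows "reducible (f * g)"
proof -
  obtain \<rho> \<rho>' where \<rho>: "\<rho> \<in> carrier (KS \<O> \<sigma>)" "f - \<rho> \<in> J" "\<rho>' \<in> carrier (KS \<O> \<sigma>)" "g - \<rho>' \<in> J"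
    using assms unfolding reducible_def by blast
  have f: "f \<in> carrier (Kc \<O>)" using assms(1) by (simp add: reducible_def)
  have "f * g - \<rho> * \<rho>' = f * (g - \<rho>') + \<rho>' * (f - \<rho>)" by (simp add: algebra_simps)
  moreover have "f * (g - \<rho>') + \<rho>' * (f - \<rho>) \<in> J"
    using ideal_poly_ringD(3)[OF ideal_J ideal_poly_ringD(4)[OF ideal_J f \<rho>(4)]
      ideal_poly_ringD(4)[OF ideal_J KS_subset_Kc[OF \<rho>(3)] \<rho>(2)]] .
  ultimately show ?thesis
    using assms \<rho> unfolding reducible_def by (metis mult_in_poly_ring)
qed

lemma reducible_minus:
  assumes "reducible f"
  shows "reducible (- f)"
  using reducible_mult[OF reducible_KS[OF minus_in_poly_ring[OF one_in_poly_ring]] assms] by simp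

lemma reducible_sum: "(\<And>x. x \<in> A \<Longrightarrow> reducible (f x)) \<Longrightarrow> reducible (sum f A)"
  by (induction A rule: infinite_finite_induct) (auto intro: reducible_add reducible_KS)

text \<open>
  A border term \<open>x\<^sub>l t\<^sub>1\<close> that is not a corner is also \<open>x\<^sub>k s\<close> with \<open>s\<close> outside \<open>\<O>\<close>. Then \<open>k \<noteq> l\<close>, so
  \<open>x\<^sub>k\<close> divides \<open>t\<^sub>1\<close>, and the quotient is the required \<open>t\<close>.
\<close>

lemma non_corner_border:
  assumes "b \<in> border \<O>" "b \<notin> corners \<O>"
  obtains k l t where "t \<in> \<O>" "Poly_Mapping.single k 1 + t \<in> \<O>" "Poly_Mapping.single l 1 + t \<in> border \<O>"
    "b = Poly_Mapping.single k 1 + (Poly_Mapping.single l 1 + t)"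
proof -
  obtain l t1 where t1: "b = Poly_Mapping.single l 1 + t1" "t1 \<in> \<O>" "b \<notin> \<O>"
    using assms(1) by (rule borderE)
  obtain s' u where s': "s' \<notin> \<O>" "b = s' + u" "s' \<noteq> b"
    using assms(2) t1(3) by (auto simp: corners_def tdvd_def)
  then have "u \<noteq> 0" by auto
  then obtain k where "k \<in> Poly_Mapping.keys u" using keys_eq_empty[of u] by blast
  then have u: "u = Poly_Mapping.single k 1 + (u - Poly_Mapping.single k 1)" by (rule trm_split)
  define s where "s = s' + (u - Poly_Mapping.single k 1)"
  have b: "b = Poly_Mapping.single k 1 + s"
    unfolding s'(2) s_def by (subst u) (simp only: add.left_commute)
  have s: "s \<notin> \<O>" using s'(1) divisor_in_O[of "u - Poly_Mapping.single k 1" s'] by (auto simp: s_def add.commute)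
  \<comment> \<open>Otherwise cancelling \<open>x\<^sub>k\<close> would identify \<open>s\<close> with \<open>t1\<close>.\<close>
  have "k \<noteq> l" using b t1(1,2) s by auto
  have "Poly_Mapping.lookup t1 k = Poly_Mapping.lookup b k"
    using \<open>k \<noteq> l\<close> by (simp add: t1(1) lookup_add lookup_single)
  then have "k \<in> Poly_Mapping.keys t1" by (simp add: b in_keys_iff lookup_add)
  then have k: "t1 = Poly_Mapping.single k 1 + (t1 - Poly_Mapping.single k 1)" by (rule trm_split)
  define t where "t = t1 - Poly_Mapping.single k 1"
  have t1_eq: "t1 = Poly_Mapping.single k 1 + t" using k by (simp only: t_def)
  have t: "t \<in> \<O>" using t1(2) divisor_in_O unfolding t1_eq by blast
  have "Poly_Mapping.single k 1 + s = Poly_Mapping.single k 1 + (Poly_Mapping.single l 1 + t)"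
    unfolding b[symmetric] t1(1) t1_eq by (rule add.left_commute)
  then have s_eq: "s = Poly_Mapping.single l 1 + t" by simp
  show thesis
  proof (rule that[of t k l])
    show "Poly_Mapping.single k 1 + t \<in> \<O>" using t1(2) unfolding t1_eq .
    show "Poly_Mapping.single l 1 + t \<in> border \<O>" using s borderI[OF t] unfolding s_eq by blast
    show "b = Poly_Mapping.single k 1 + (Poly_Mapping.single l 1 + t)" using b unfolding s_eq .
  qed (rule t)
qed

lemma add_left_lt: "s \<prec> t \<Longrightarrow> u + s \<prec> u + t"
  using add_left_le by simp

text \<open>
  With \<open>b = x\<^sub>k x\<^sub>l t\<close> as in \<open>non_corner_border\<close> and \<open>s = x\<^sub>l t\<close>, the entry of the commutator in row \<open>i\<close> and
  column \<open>t\<close> is \<open>\<Sum>\<^sub>u A\<^sub>k(i, u) c(u, s) - c(i, b)\<close>. Modulo \<open>L_ideal\<close> only the terms \<open>u < s\<close> contribute, and for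
  these \<open>A\<^sub>k(i, u)\<close> is a constant or the coefficient \<open>c(i, x\<^sub>k u)\<close> with \<open>x\<^sub>k u < x\<^sub>k s = b\<close>. Induction along \<open>\<sigma>\<close>
  therefore reduces \<open>c(i, b)\<close>.
\<close>

lemma reducible_Var: "b \<in> border \<O> \<Longrightarrow> i \<in> \<O> \<Longrightarrow> reducible (Var (i, b))"
  using wf_lt
proof (induction b arbitrary: i rule: wf_induct_rule)
  case (less b)
  have Var_J: "reducible (Var (i, b))" if "i \<in> \<O>" "b \<in> border \<O>" "\<not> i \<preceq> b" for i b
    using that by (intro reducible_J Var_in_J) (auto simp: c_indices_def S_full_iff)
  show ?case
  proof (cases "b \<in> corners \<O>")
    case True
    show ?thesis
    proof (cases "i \<preceq> b")
      case True
      then show ?thesis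
        using less.prems \<open>b \<in> corners \<O>\<close> by (intro reducible_KS Var_in_poly_ring) (simp add: S_corner_iff)
    qed (use Var_J less.prems in blast)
  next
    case False
    obtain k l t where t: "t \<in> \<O>" "Poly_Mapping.single k 1 + t \<in> \<O>" "Poly_Mapping.single l 1 + t \<in> border \<O>"
      and b: "b = Poly_Mapping.single k 1 + (Poly_Mapping.single l 1 + t)"
      using non_corner_border[OF less.prems(1) False] by metis
    define s where "s = Poly_Mapping.single l 1 + t"
    have s: "s \<in> border \<O>" "b = Poly_Mapping.single k 1 + s" using t(3) b by (simp_all only: s_def)
    have "s \<prec> b"
      using add_left_lt[of 0 "Poly_Mapping.single k 1" s] zero_le unfolding s(2)
      by (metis add.commute add.right_neutral lookup_single_eq lookup_zero one_neq_zero)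
    let ?p = "(\<Sum>u\<in>\<O>. mult_matrix \<O> k i u * mult_matrix \<O> l u t) :: ('x cidx, 'a) mpoly"
    let ?q = "(\<Sum>u\<in>\<O>. mult_matrix \<O> l i u * mult_matrix \<O> k u t) :: ('x cidx, 'a) mpoly"
    \<comment> \<open>\<open>?q\<close> collapses to one summand since column \<open>t\<close> of the \<open>k\<close>th matrix is a unit vector.\<close>
    have rpq: "reducible (?p - ?q)"
      using t(1) less.prems(2) by (intro reducible_J commutator_in_J) blast
    have "?q = mult_matrix \<O> l i (Poly_Mapping.single k 1 + t)"
      using t(2) by (simp add: mult_matrix_def[of _ k _ t] Let_def sum.delta if_distrib[where f = "\<lambda>x. _ * x"] cong: if_cong)
    also have "\<dots> = Var (i, b)"
      using border_disjoint[OF less.prems(1)] unfolding mult_matrix_def b Let_def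
      by (simp add: add.left_commute)
    finally have q: "?q = Var (i, b)" .
    have "reducible (mult_matrix \<O> k i u * mult_matrix \<O> l u t :: ('x cidx, 'a) mpoly)" if u: "u \<in> \<O>" for u
    proof -
      have Vu: "mult_matrix \<O> l u t = (Var (u, s) :: ('x cidx, 'a) mpoly)"
        using border_disjoint[OF s(1)] by (simp add: mult_matrix_def Let_def s_def)
      show ?thesis
      proof (cases "u \<preceq> s")
        case False
        then have "Var (u, s) \<in> J" using u s(1) by (intro Var_in_J) (auto simp: c_indices_def S_full_iff)
        then show ?thesis
          unfolding Vu by (intro reducible_J ideal_poly_ringD(4)[OF ideal_J] mult_matrix_in_Kc less.prems(2) u)
      next
        case True
        have "u \<noteq> s" using u border_disjoint[OF s(1)] by blast
        then have lt: "Poly_Mapping.single k 1 + u \<prec> b" using True add_left_lt unfolding s(2) by blast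
        have "reducible (mult_matrix \<O> k i u :: ('x cidx, 'a) mpoly)"
        proof (cases "Poly_Mapping.single k 1 + u \<in> \<O>")
          case True
          then show ?thesis by (auto simp: mult_matrix_def Let_def intro: reducible_KS)
        next
          case False
          then have "reducible (Var (i, Poly_Mapping.single k 1 + u) :: ('x cidx, 'a) mpoly)"
            using less.IH[OF _ borderI[OF u False] less.prems(2)] lt by blast
          then show ?thesis using False by (simp add: mult_matrix_def Let_def)
        qed
        moreover have "reducible (Var (u, s) :: ('x cidx, 'a) mpoly)"
          using less.IH[OF _ s(1) u] \<open>s \<prec> b\<close> by blast
        ultimately show ?thesis unfolding Vu by (rule reducible_mult)
      qed
    qed
    then have rp: "reducible ?p" by (rule reducible_sum)
    have "reducible (?p + - (?p - ?q))"
      by (rule reducible_add[OF rp reducible_minus[OF rpq]])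
    then show ?thesis unfolding q by simp
  qed
qed

lemma Kc_reduces_to_KS:
  assumes "f \<in> carrier (Kc \<O>)"
  shows "\<exists>\<rho>\<in>carrier (KS \<O> \<sigma>). f - \<rho> \<in> J"
proof -
  have "reducible f"
    using assms
    by (induction f rule: poly_ring_induct)
      (auto intro: reducible_KS reducible_add reducible_mult reducible_Var simp: c_indices_def)
  then show ?thesis by (simp add: reducible_def)
qed

lemma gb_scheme_ideal_iff: "f \<in> gb_scheme_ideal \<O> \<sigma> \<longleftrightarrow> f \<in> J \<and> f \<in> carrier (KS \<O> \<sigma>)"
  by (simp add: gb_scheme_ideal_def)

text \<open>
  Every indeterminate gets the value at \<open>a\<close> of a polynomial in \<open>S_corner \<O> \<sigma>\<close> congruent to it. Evaluating
  \<open>f\<close> at the new tuple then amounts to evaluating some \<open>r \<in> K[S]\<close> congruent to \<open>f\<close> at \<open>a\<close>. For \<open>f \<in> J\<close>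
  also \<open>r \<in> J\<close>, hence \<open>r\<close> is in \<open>gb_scheme_ideal \<O> \<sigma>\<close> and vanishes at \<open>a\<close>.
\<close>

lemma extend_point:
  fixes a :: "'x cidx \<Rightarrow> 'k::field"
  assumes a: "\<And>f. f \<in> gb_scheme_ideal \<O> \<sigma> \<Longrightarrow> subst id a f = 0"
  shows "\<exists>A. (\<forall>c\<in>S_corner \<O> \<sigma>. A c = a c) \<and> order_compatible A \<and> commuting A"
proof -
  have "\<forall>c\<in>c_indices \<O>. \<exists>\<rho>\<in>carrier (KS \<O> \<sigma>). (Var c :: ('x cidx, 'k) mpoly) - \<rho> \<in> J"
    by (intro ballI Kc_reduces_to_KS Var_in_poly_ring)
  then obtain \<rho> :: "'x cidx \<Rightarrow> ('x cidx, 'k) mpoly"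
    where \<rho>: "\<And>c. c \<in> c_indices \<O> \<Longrightarrow> \<rho> c \<in> carrier (KS \<O> \<sigma>)"
      "\<And>c. c \<in> c_indices \<O> \<Longrightarrow> Var c - \<rho> c \<in> J"
    by metis
  define A where "A c = subst id a (\<rho> c)" for c
  have A_a: "A c = a c" if "c \<in> S_corner \<O> \<sigma>" for c
  proof -
    have c: "c \<in> c_indices \<O>" using that S_corner_subset by blast
    have "Var c - \<rho> c \<in> gb_scheme_ideal \<O> \<sigma>"
      unfolding gb_scheme_ideal_iff by (intro conjI diff_in_poly_ring Var_in_poly_ring \<rho> c that)
    then have "subst id a (Var c - \<rho> c) = 0" by (rule a)
    then show ?thesis by (simp add: A_def)
  qed
  note J' = ideal_poly_ringD(3)[OF ideal_J] ideal_poly_ringD(4)[OF ideal_J]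
  have ev: "f \<in> carrier (Kc \<O>) \<and> (\<exists>r\<in>carrier (KS \<O> \<sigma>). f - r \<in> J \<and> subst id A f = subst id a r)"
    if "f \<in> carrier (Kc \<O>)" for f
    using that
  proof (induction f rule: poly_ring_induct)
    case (Const c)
    show ?case
      by (intro conjI bexI[of _ "Const c"]) (simp_all add: ideal_poly_ringD(2)[OF ideal_J] id_hom.subst_Const del: id_apply)
  next
    case (Var c)
    then show ?case using \<rho>[OF Var] by (intro conjI bexI[of _ "\<rho> c"]) (simp_all only: id_hom.subst_Var A_def Var_in_poly_ring)
  next
    case (add p q)
    then obtain r r' where r: "r \<in> carrier (KS \<O> \<sigma>)" "p - r \<in> J" "subst id A p = subst id a r"
      "r' \<in> carrier (KS \<O> \<sigma>)" "q - r' \<in> J" "subst id A q = subst id a r'" by blast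
    have "p + q - (r + r') = (p - r) + (q - r')" by simp
    then have "p + q - (r + r') \<in> J" using J'(1)[OF r(2,5)] by (simp only:)
    then show ?case using add r by (intro conjI bexI[of _ "r + r'"]) (simp_all only: id_hom.subst_add add_in_poly_ring)
  next
    case (mult p q)
    then obtain r r' where r: "r \<in> carrier (KS \<O> \<sigma>)" "p - r \<in> J" "subst id A p = subst id a r"
      "r' \<in> carrier (KS \<O> \<sigma>)" "q - r' \<in> J" "subst id A q = subst id a r'" by blast
    have "p * q - r * r' = p * (q - r') + r' * (p - r)" by (simp add: algebra_simps)
    moreover have "p * (q - r') + r' * (p - r) \<in> J"
      by (intro J'(1) J'(2)[OF _ r(5)] J'(2)[OF _ r(2)] KS_subset_Kc[OF r(4)]) (use mult in blast)
    ultimately have "p * q - r * r' \<in> J" by simp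
    then show ?case using mult r by (intro conjI bexI[of _ "r * r'"]) (simp_all only: id_hom.subst_mult mult_in_poly_ring)
  qed
  have "subst id A f = 0" if f: "f \<in> J" for f
  proof -
    obtain r where r: "r \<in> carrier (KS \<O> \<sigma>)" "f - r \<in> J" "subst id A f = subst id a r"
      using ev[OF ideal_poly_ringD(1)[OF ideal_J f]] by blast
    have "f - (f - r) \<in> J" using ideal_poly_ringD(6)[OF ideal_J f r(2)] .
    then have "r \<in> gb_scheme_ideal \<O> \<sigma>" using r(1) by (simp add: gb_scheme_ideal_iff)
    then show ?thesis using a r(3) by simp
  qed
  then have "order_compatible A \<and> commuting A" by (intro vanishing_on_J_iff[THEN iffD1] ballI)
  with A_a show ?thesis by (intro exI[of _ A]) simp
qed

section \<open>Rational points and ideals\<close>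

lemma prebasis_cong:
  assumes "\<And>c. c \<in> S_corner \<O> \<sigma> \<Longrightarrow> A c = a c" "b \<in> corners \<O>"
  shows "prebasis A b = prebasis a b"
  unfolding prebasis_def using assms by (intro arg_cong2[where f = "(-)"] refl sum.cong) (auto simp: S_corner_iff)

lemma rename_Term: "subst Const f (rename Inl (Term t)) = subst Const (\<lambda>k. f (Inl k)) (Term t)"
proof (induction t rule: trm_induct)
  case zero
  show ?case by (simp add: rename_def)
next
  case (var_add k m)
  then show ?case by (simp only: Term_add Term_single rename_def Const_hom.subst_mult Const_hom.subst_Var)
qed

lemma subst_Const_Var_id: "subst Const Var p = p"
  using UNIV_I[of p, folded carrier_poly_ring_UNIV] by (induction p rule: poly_ring_induct) simp_all

lemma specialize_g_star: "specialize a (g_star \<O> \<sigma> b) = prebasis a b"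
  by (simp add: specialize_def g_star_def prebasis_def rename_Term subst_Const_Var_id)

lemma specialized_prebasis_eq: "specialized_prebasis \<O> \<sigma> a = prebasis a ` corners \<O>"
  by (simp add: specialized_prebasis_def specialize_g_star)

lemma point_to_ideal_eq: "point_to_ideal \<O> \<sigma> a = prebasis_ideal a"
  by (simp add: point_to_ideal_def specialized_prebasis_eq)

lemma rational_point_extends:
  assumes "a \<in> rational_points \<O> \<sigma>"
  obtains A where "order_compatible A" "commuting A" "\<And>c. c \<in> S_corner \<O> \<sigma> \<Longrightarrow> A c = a c"
    "prebasis A ` corners \<O> = prebasis a ` corners \<O>"
proof -
  obtain A where "\<forall>c\<in>S_corner \<O> \<sigma>. A c = a c" "order_compatible A" "commuting A"
    using assms extend_point[of a] by (auto simp: rational_points_def)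
  then show thesis using that prebasis_cong[of A a] by (auto simp: image_iff intro!: that[of A] image_cong)
qed

lemma rational_point_reduced_groebner:
  assumes "a \<in> rational_points \<O> \<sigma>"
  shows "reduced_groebner_basis \<sigma> (point_to_ideal \<O> \<sigma> a) (specialized_prebasis \<O> \<sigma> a)"
proof -
  obtain A where "order_compatible A" "commuting A" "prebasis A ` corners \<O> = prebasis a ` corners \<O>"
    using rational_point_extends[OF assms] by metis
  then show ?thesis using prebasis_reduced_groebner[of A] by (simp add: point_to_ideal_eq specialized_prebasis_eq)
qed

lemma rational_point_ideal_with_complement:
  assumes "a \<in> rational_points \<O> \<sigma>"
  shows "ideal_with_complement \<sigma> \<O> (point_to_ideal \<O> \<sigma> a)"
proof (intro ideal_with_complement.intro ideal_with_complement_axioms.intro term_order_ideal_axioms)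
  obtain A where "order_compatible A" "commuting A" "prebasis A ` corners \<O> = prebasis a ` corners \<O>"
    using rational_point_extends[OF assms] by metis
  then show "complement_of_lead_terms \<sigma> (point_to_ideal \<O> \<sigma> a) = \<O>"
    using prebasis_ideal_complement[of A] by (simp add: point_to_ideal_eq)
  show "ideal (point_to_ideal \<O> \<sigma> a) P_ring"
    unfolding point_to_ideal_eq by (rule ideal_prebasis_ideal)
qed

text \<open>
  The difference of two prebasis elements with the same corner is supported on \<open>\<O>\<close>, so it can only lie
  in the common ideal if it is zero.
\<close>

lemma point_to_ideal_inj:
  assumes a: "a \<in> rational_points \<O> \<sigma>" "b \<in> rational_points \<O> \<sigma>"
    and eq: "point_to_ideal \<O> \<sigma> a = point_to_ideal \<O> \<sigma> b"
  shows "a = b"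
proof (rule PiE_ext)
  show "a \<in> S_corner \<O> \<sigma> \<rightarrow>\<^sub>E UNIV" "b \<in> S_corner \<O> \<sigma> \<rightarrow>\<^sub>E UNIV"
    using a by (auto simp: rational_points_def)
  fix c assume "c \<in> S_corner \<O> \<sigma>"
  then obtain t s where c: "c = (t, s)" "t \<in> \<O>" "s \<in> corners \<O>" "t \<preceq> s"
    by (cases c) (auto simp: S_corner_iff)
  interpret ideal_with_complement \<sigma> \<O> "point_to_ideal \<O> \<sigma> a"
    by (rule rational_point_ideal_with_complement[OF a(1)])
  have "prebasis a s - prebasis b s \<in> point_to_ideal \<O> \<sigma> a"
    using ideal_P_ringD(5)[OF ideal_I] prebasis_in_ideal[OF c(3)] eq by (metis point_to_ideal_eq)
  moreover have "Poly_Mapping.keys (prebasis a s - prebasis b s) \<subseteq> \<O>"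
    by (auto simp: in_keys_iff lookup_minus lookup_prebasis split: if_splits)
  ultimately have "prebasis a s - prebasis b s = 0" by (rule in_I_keys_O)
  then have "Poly_Mapping.lookup (prebasis a s) t = Poly_Mapping.lookup (prebasis b s) t" by simp
  moreover have "t \<noteq> s" using c by (auto simp: corners_def)
  ultimately show "a c = b c" using c by (simp add: lookup_prebasis)
qed

end

context ideal_with_complement
begin

text \<open>
  The structure constants of \<open>K[x]/I\<close> with respect to the basis \<open>\<O>\<close>.
\<close>

definition coord :: "'a cidx \<Rightarrow> 'k"
  where "coord = (\<lambda>(s, b). Poly_Mapping.lookup (nf (Term b)) s)"

lemma mulmat_coord:
  "mulmat coord k s t = Poly_Mapping.lookup (nf (Term (Poly_Mapping.single k 1 + t))) s"
proof (cases "Poly_Mapping.single k 1 + t \<in> \<O>")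
  case True
  then have "nf (Term (Poly_Mapping.single k 1 + t)) = Term (Poly_Mapping.single k 1 + t)"
    using ideal_P_ringD(1)[OF ideal_I] by (intro nf_eqI) (auto simp: Term_def)
  with True show ?thesis by (simp add: mulmat_def Let_def lookup_Term)
qed (simp add: mulmat_def coord_def Let_def)

lemma order_compatible_coord: "order_compatible coord"
  using keys_nf keys_nf_Term by (fastforce simp: order_compatible_def c_indices_def S_full_iff coord_def in_keys_iff)

text \<open>
  Both sides are coefficients of the normal form of \<open>x\<^sub>k x\<^sub>l t\<close>; on the left, \<open>x\<^sub>l t\<close> is reduced to its
  normal form \<open>q\<close> before multiplying by \<open>x\<^sub>k\<close>. The right-hand side is symmetric in \<open>k\<close> and \<open>l\<close>.
\<close>

lemma mulmat_coord_product:
  "(\<Sum>u\<in>\<O>. mulmat coord k s u * mulmat coord l u t) =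
    Poly_Mapping.lookup (nf (Term (Poly_Mapping.single k 1 + (Poly_Mapping.single l 1 + t)))) s"
proof -
  define q where "q = nf (Term (Poly_Mapping.single l 1 + t))"
  define r where "r = (\<Sum>u\<in>\<O>. Const (Poly_Mapping.lookup q u) * nf (Term (Poly_Mapping.single k 1 + u)))"
  have "q = (\<Sum>u\<in>\<O>. Const (Poly_Mapping.lookup q u) * Term u)"
    by (subst mpoly_expansion, rule sum.mono_neutral_left) (use keys_nf q_def in auto)
  from arg_cong[OF this, of "(*) (Var k)"]
  have "Var k * q = (\<Sum>u\<in>\<O>. Var k * (Const (Poly_Mapping.lookup q u) * Term u))"
    by (simp only: sum_distrib_left)
  also have "\<dots> = (\<Sum>u\<in>\<O>. Const (Poly_Mapping.lookup q u) * Term (Poly_Mapping.single k 1 + u))"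
    by (simp only: Term_add Term_single mult.left_commute)
  finally have "Var k * q - r =
      (\<Sum>u\<in>\<O>. Const (Poly_Mapping.lookup q u) * (Term (Poly_Mapping.single k 1 + u) - nf (Term (Poly_Mapping.single k 1 + u))))"
    by (simp add: r_def right_diff_distrib sum_subtractf)
  also have "\<dots> \<in> I" by (intro ideal_P_sum[OF ideal_I] ideal_P_ringD(3)[OF ideal_I] diff_nf)
  finally have 1: "Var k * q - r \<in> I" .
  have "Term (Poly_Mapping.single k 1 + (Poly_Mapping.single l 1 + t)) - Var k * q
      = Var k * (Term (Poly_Mapping.single l 1 + t) - q)"
    unfolding Term_add[of "Poly_Mapping.single k 1"] Term_single by (simp add: right_diff_distrib)
  also have "\<dots> \<in> I" unfolding q_def by (intro ideal_P_ringD(3)[OF ideal_I] diff_nf)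
  finally have "Term (Poly_Mapping.single k 1 + (Poly_Mapping.single l 1 + t)) - r \<in> I"
    by (rule ideal_P_trans[OF ideal_I _ 1])
  moreover have "Poly_Mapping.keys r \<subseteq> \<O>" unfolding r_def by (intro keys_subset_intros keys_nf)
  ultimately have nf: "nf (Term (Poly_Mapping.single k 1 + (Poly_Mapping.single l 1 + t))) = r" by (intro nf_eqI)
  have "Poly_Mapping.lookup r s =
      (\<Sum>u\<in>\<O>. Poly_Mapping.lookup (nf (Term (Poly_Mapping.single k 1 + u))) s * Poly_Mapping.lookup q u)"
    by (simp add: r_def lookup_sum) (simp only: mult.commute)
  then show ?thesis by (simp only: mulmat_coord q_def nf)
qed

lemma commuting_coord: "commuting coord"
  by (simp only: commuting_def mulmat_coord_product add.left_commute simp_thms Ball_def)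

lemma coord_rational: "restrict coord (S_corner \<O> \<sigma>) \<in> rational_points \<O> \<sigma>"
proof -
  have "subst id (restrict coord (S_corner \<O> \<sigma>)) f = 0" if "f \<in> gb_scheme_ideal \<O> \<sigma>" for f
  proof -
    have "subst id coord f = 0"
      using vanishing_on_J_iff[of coord] order_compatible_coord commuting_coord that by (simp add: gb_scheme_ideal_iff)
    then show ?thesis
      using subst_id_cong[of f "S_corner \<O> \<sigma>" coord "restrict coord (S_corner \<O> \<sigma>)"] that
      by (simp add: gb_scheme_ideal_iff)
  qed
  then show ?thesis by (simp add: rational_points_def)
qed

text \<open>
  The prebasis elements are \<open>b - nf b \<in> I\<close>, which gives one inclusion. As both ideals have complement \<open>\<O>\<close>, the
  normal form of \<open>f \<in> I\<close> modulo the smaller ideal lies in \<open>I\<close> and is supported on \<open>\<O>\<close>, so it is zero.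
\<close>

lemma point_to_ideal_coord: "point_to_ideal \<O> \<sigma> (restrict coord (S_corner \<O> \<sigma>)) = I"
proof
  let ?a = "restrict coord (S_corner \<O> \<sigma>)"
  interpret a: ideal_with_complement \<sigma> \<O> "point_to_ideal \<O> \<sigma> ?a"
    by (rule rational_point_ideal_with_complement[OF coord_rational])
  have "prebasis ?a b \<in> I" if "b \<in> corners \<O>" for b
  proof -
    have "prebasis ?a b = prebasis coord b" by (rule prebasis_cong[symmetric]) (use that in simp_all)
    also have "\<dots> = Term b - nf (Term b)"
    proof (rule poly_mapping_eqI)
      fix s
      have "s \<in> \<O>" "s \<preceq> b" "s \<noteq> b" if "s \<in> Poly_Mapping.keys (nf (Term b))"
        using that keys_nf keys_nf_Term \<open>b \<in> corners \<O>\<close> by (auto simp: corners_def)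
      then show "Poly_Mapping.lookup (prebasis coord b) s = Poly_Mapping.lookup (Term b - nf (Term b)) s"
        by (cases "s \<in> Poly_Mapping.keys (nf (Term b))") (auto simp: lookup_prebasis lookup_minus lookup_Term coord_def)
    qed
    finally show ?thesis using diff_nf by simp
  qed
  then show sub: "point_to_ideal \<O> \<sigma> ?a \<subseteq> I"
    unfolding point_to_ideal_eq by (intro ring.genideal_minimal[OF ring_P_ring ideal_I]) auto
  show "I \<subseteq> point_to_ideal \<O> \<sigma> ?a"
  proof
    fix f assume "f \<in> I"
    then have "f - (f - a.nf f) \<in> I" using a.diff_nf sub ideal_P_ringD(5)[OF ideal_I] by blast
    then have "a.nf f = 0" using in_I_keys_O[OF _ a.keys_nf[of f]] by simp
    then show "f \<in> point_to_ideal \<O> \<sigma> ?a" using a.diff_nf[of f] by simp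
  qed
qed

end

context term_order_ideal
begin

lemma bij_betw_point_to_ideal:
  "bij_betw (point_to_ideal \<O> \<sigma>) (rational_points \<O> \<sigma> :: ('x cidx \<Rightarrow> 'k::field) set) (ideals_with_complement \<O> \<sigma>)"
proof (rule bij_betw_imageI)
  show "inj_on (point_to_ideal \<O> \<sigma>) (rational_points \<O> \<sigma> :: ('x cidx \<Rightarrow> 'k) set)"
    by (rule inj_onI) (rule point_to_ideal_inj)
  show "point_to_ideal \<O> \<sigma> ` (rational_points \<O> \<sigma> :: ('x cidx \<Rightarrow> 'k) set) = ideals_with_complement \<O> \<sigma>"
  proof (intro equalityI subsetI)
    fix I :: "('x, 'k) mpoly set" assume "I \<in> point_to_ideal \<O> \<sigma> ` rational_points \<O> \<sigma>"
    then interpret ideal_with_complement \<sigma> \<O> I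
      using rational_point_ideal_with_complement by blast
    show "I \<in> ideals_with_complement \<O> \<sigma>"
      using zero_dimensional_I complement by (simp add: ideals_with_complement_def)
  next
    fix I :: "('x, 'k) mpoly set" assume "I \<in> ideals_with_complement \<O> \<sigma>"
    then interpret ideal_with_complement \<sigma> \<O> I
      by (intro ideal_with_complement.intro ideal_with_complement_axioms.intro term_order_ideal_axioms)
        (auto simp: ideals_with_complement_def zero_dimensional_def)
    show "I \<in> point_to_ideal \<O> \<sigma> ` rational_points \<O> \<sigma>"
      using coord_rational point_to_ideal_coord by (metis image_eqI)
  qed
qed

end


section \<open>Quotients of polynomial rings\<close>

text \<open>
  Two quotient maps of a ring with the same kernel have canonically isomorphic targets. The form with explicit
  \<open>q\<close> and \<open>h\<close> also covers iterated quotients such as the fiber.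
\<close>

lemma ring_iso_of_equal_kernels:
  fixes R (structure) and S (structure) and T (structure)
  assumes R: "ring R" and S: "ring S" and T: "ring T"
    and q: "q \<in> ring_hom R S" "q ` carrier R = carrier S"
    and h: "h \<in> ring_hom R T" "h ` carrier R = carrier T"
    and ker: "\<And>x. x \<in> carrier R \<Longrightarrow> q x = \<zero>\<^bsub>S\<^esub> \<longleftrightarrow> h x = \<zero>\<^bsub>T\<^esub>"
  shows "\<exists>\<phi>\<in>ring_iso S T. \<forall>x\<in>carrier R. \<phi> (q x) = h x"
proof -
  have eq_iff: "f x = f y \<longleftrightarrow> f (x \<ominus>\<^bsub>R\<^esub> y) = \<zero>\<^bsub>U\<^esub>"
    if "ring U" "f \<in> ring_hom R U" "x \<in> carrier R" "y \<in> carrier R" for U :: "('u, 'm) ring_scheme" and f x y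
  proof -
    interpret ring_hom_ring R U f by (rule ring_hom_ringI2) (use R that in auto)
    show ?thesis
      using that S.r_right_minus_eq[of "f x" "f y"] by (simp add: a_minus_def)
  qed
  have qh: "q x = q y \<longleftrightarrow> h x = h y" if "x \<in> carrier R" "y \<in> carrier R" for x y
    using eq_iff[OF S q(1) that] eq_iff[OF T h(1) that] ker[of "x \<ominus>\<^bsub>R\<^esub> y"] ring.ring_simprules(4)[OF R that] R that
    by simp
  define \<phi> where "\<phi> s = h (SOME x. x \<in> carrier R \<and> q x = s)" for s
  have \<phi>: "\<phi> (q x) = h x" if "x \<in> carrier R" for x
  proof -
    have "(SOME y. y \<in> carrier R \<and> q y = q x) \<in> carrier R \<and> q (SOME y. y \<in> carrier R \<and> q y = q x) = q x"
      by (rule someI[where x = x]) (use that in simp)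
    then show ?thesis unfolding \<phi>_def using qh that by blast
  qed
  have lift: "\<exists>x\<in>carrier R. s = q x" if "s \<in> carrier S" for s
    using that q(2) by auto
  have "\<phi> \<in> ring_iso S T"
  proof (rule ring_iso_memI)
    show "\<phi> s \<in> carrier T" if "s \<in> carrier S" for s
      using lift[OF that] \<phi> h(2) by auto
    show "\<phi> (s \<otimes>\<^bsub>S\<^esub> t) = \<phi> s \<otimes>\<^bsub>T\<^esub> \<phi> t" if st: "s \<in> carrier S" "t \<in> carrier S" for s t
    proof -
      obtain x y where x: "x \<in> carrier R" "s = q x" "y \<in> carrier R" "t = q y" using lift[OF st(1)] lift[OF st(2)] by blast
      have "s \<otimes>\<^bsub>S\<^esub> t = q (x \<otimes>\<^bsub>R\<^esub> y)" using x ring_hom_mult[OF q(1)] by simp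
      then show ?thesis
        using x ring_hom_mult[OF h(1)] ring.ring_simprules(5)[OF R] by (simp add: \<phi>)
    qed
    show "\<phi> (s \<oplus>\<^bsub>S\<^esub> t) = \<phi> s \<oplus>\<^bsub>T\<^esub> \<phi> t" if st: "s \<in> carrier S" "t \<in> carrier S" for s t
    proof -
      obtain x y where x: "x \<in> carrier R" "s = q x" "y \<in> carrier R" "t = q y" using lift[OF st(1)] lift[OF st(2)] by blast
      have "s \<oplus>\<^bsub>S\<^esub> t = q (x \<oplus>\<^bsub>R\<^esub> y)" using x ring_hom_add[OF q(1)] by simp
      then show ?thesis
        using x ring_hom_add[OF h(1)] ring.ring_simprules(1)[OF R] by (simp add: \<phi>)
    qed
    show "\<phi> \<one>\<^bsub>S\<^esub> = \<one>\<^bsub>T\<^esub>"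
      using \<phi>[of "\<one>\<^bsub>R\<^esub>"] ring_hom_one[OF q(1)] ring_hom_one[OF h(1)] ring.ring_simprules(6)[OF R] by simp
    show "bij_betw \<phi> (carrier S) (carrier T)"
    proof (rule bij_betw_imageI)
      show "inj_on \<phi> (carrier S)"
        using lift \<phi> qh by (intro inj_onI) metis
      show "\<phi> ` carrier S = carrier T"
        unfolding q(2)[symmetric] h(2)[symmetric] using \<phi> by (auto simp: image_iff)
    qed
  qed
  with \<phi> show ?thesis by blast
qed

context
  fixes V :: "'v set" and I :: "('v, 'k::comm_ring_1) mpoly set"
  assumes I: "ideal I (poly_ring V)"
begin

lemma coset_poly_ring: "I +>\<^bsub>poly_ring V\<^esub> f = {i + f | i. i \<in> I}"
  by (auto simp: a_r_coset_def r_coset_def)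

lemma quotE:
  assumes "X \<in> carrier (poly_ring V Quot I)"
  obtains f where "f \<in> carrier (poly_ring V)" "X = I +>\<^bsub>poly_ring V\<^esub> f"
  using assms by (auto simp: FactRing_def A_RCOSETS_def')

lemma coset_in_quot: "f \<in> carrier (poly_ring V) \<Longrightarrow> I +>\<^bsub>poly_ring V\<^esub> f \<in> carrier (poly_ring V Quot I)"
  by (auto simp: FactRing_def A_RCOSETS_def')

lemma coset_image_carrier: "(+>\<^bsub>poly_ring V\<^esub>) I ` carrier (poly_ring V) = carrier (poly_ring V Quot I)"
  using coset_in_quot by (auto elim: quotE)

lemma coset_eq_iff:
  "f \<in> carrier (poly_ring V) \<Longrightarrow> g \<in> carrier (poly_ring V) \<Longrightarrow>
    I +>\<^bsub>poly_ring V\<^esub> f = I +>\<^bsub>poly_ring V\<^esub> g \<longleftrightarrow> f - g \<in> I"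
  using ring.quotient_eq_iff_same_a_r_cos[OF ring_poly_ring I] by (simp add: a_minus_poly_ring)

lemma coset_eq_zero_iff:
  "f \<in> carrier (poly_ring V) \<Longrightarrow> I +>\<^bsub>poly_ring V\<^esub> f = I \<longleftrightarrow> f \<in> I"
  using ring.a_rcos_zero[OF ring_poly_ring I] ideal.rcos_const_imp_mem[OF I] by blast

lemma ideal_coset_vimage:
  "ideal B (poly_ring V Quot I) \<Longrightarrow> ideal {f \<in> carrier (poly_ring V). I +>\<^bsub>poly_ring V\<^esub> f \<in> B} (poly_ring V)"
  by (rule ring_hom_ring.ideal_vimage[OF ideal.rcos_ring_hom_ring[OF I]])

lemma ideal_coset_image:
  "ideal A (poly_ring V) \<Longrightarrow> ideal ((+>\<^bsub>poly_ring V\<^esub>) I ` A) (poly_ring V Quot I)"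
  by (rule ring.ring_ideal_imp_quot_ideal[OF ring_poly_ring I])

lemma coset_mem_image_iff:
  assumes "ideal A (poly_ring V)" "I \<subseteq> A" "f \<in> carrier (poly_ring V)"
  shows "I +>\<^bsub>poly_ring V\<^esub> f \<in> (+>\<^bsub>poly_ring V\<^esub>) I ` A \<longleftrightarrow> f \<in> A"
proof
  assume "I +>\<^bsub>poly_ring V\<^esub> f \<in> (+>\<^bsub>poly_ring V\<^esub>) I ` A"
  then obtain g where g: "g \<in> A" "I +>\<^bsub>poly_ring V\<^esub> f = I +>\<^bsub>poly_ring V\<^esub> g" by blast
  then have "f - g \<in> A"
    using coset_eq_iff assms ideal_poly_ringD(1)[OF assms(1)] by blast
  then show "f \<in> A" using ideal_poly_ringD(3)[OF assms(1) _ g(1)] by fastforce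
qed simp

end

section \<open>Specialization\<close>

lemma rename_simps [simp]:
  "rename f (Const c) = Const c" "rename f (Var v) = Var (f v)" "rename f (p + q) = rename f p + rename f q"
  "rename f (p * q) = rename f p * rename f q" "rename f (p - q) = rename f p - rename f q" "rename f 0 = 0" "rename f 1 = 1"
  by (simp_all add: rename_def)

lemma specialize_simps [simp]:
  "specialize a (Const e) = Const e" "specialize a (Var (Inl k)) = Var k" "specialize a (Var (Inr c)) = Const (a c)"
  "specialize a (p + q) = specialize a p + specialize a q"
  "specialize a (p * q) = specialize a p * specialize a q" "specialize a (p - q) = specialize a p - specialize a q"
  "specialize a 0 = 0" "specialize a 1 = 1"
  by (simp_all add: specialize_def)

lemma specialize_rename_Inl [simp]: "specialize a (rename Inl p) = p"
  using UNIV_I[of p, folded carrier_poly_ring_UNIV] by (induction p rule: poly_ring_induct) simp_all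

lemma specialize_rename_Inr [simp]: "specialize a (rename Inr p) = Const (subst id a p)"
  using UNIV_I[of p, folded carrier_poly_ring_UNIV]
  by (induction p rule: poly_ring_induct)
    (simp_all only: rename_simps specialize_simps id_hom.subst_Const id_hom.subst_Var id_hom.subst_add
      id_hom.subst_mult Const_add Const_mult, simp_all only: id_apply)

lemma rename_in_poly_ring:
  assumes "p \<in> carrier (poly_ring V)" "f ` V \<subseteq> W"
  shows "rename f p \<in> carrier (poly_ring W)"
  using assms(1) by (induction p rule: poly_ring_induct) (use assms(2) in \<open>auto intro: poly_ring_closed\<close>)

context term_order_ideal
begin

lemma rename_Inl_in_KxS: "rename Inl p \<in> carrier (KxS \<O> \<sigma>)"
  by (rule rename_in_poly_ring[of p UNIV]) auto

lemma rename_Inr_in_KxS: "p \<in> carrier (KS \<O> \<sigma>) \<Longrightarrow> rename Inr p \<in> carrier (KxS \<O> \<sigma>)"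
  by (rule rename_in_poly_ring) auto

lemma g_star_in_KxS: "b \<in> corners \<O> \<Longrightarrow> g_star \<O> \<sigma> b \<in> carrier (KxS \<O> \<sigma>)"
  unfolding g_star_def
  by (intro diff_in_poly_ring sum_in_poly_ring mult_in_poly_ring Var_in_poly_ring rename_Inl_in_KxS)
    (auto simp: S_corner_iff)

lemma ideal_gb: "ideal (gb_scheme_ideal \<O> \<sigma>) (KS \<O> \<sigma>)"
  unfolding ideal_poly_ring_iff
proof (intro conjI ballI)
  note J' = ideal_poly_ringD[OF ideal_J]
  fix p q r :: "('x cidx, 'a) mpoly"
  assume "p \<in> gb_scheme_ideal \<O> \<sigma>"
  then have p: "p \<in> J" "p \<in> carrier (KS \<O> \<sigma>)" by (simp_all only: gb_scheme_ideal_iff)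
  {
    assume "q \<in> gb_scheme_ideal \<O> \<sigma>"
    then have "q \<in> J" "q \<in> carrier (KS \<O> \<sigma>)" by (simp_all only: gb_scheme_ideal_iff)
    then show "p + q \<in> gb_scheme_ideal \<O> \<sigma>"
      unfolding gb_scheme_ideal_iff by (intro conjI J'(3) add_in_poly_ring p)
  }
  {
    assume "r \<in> carrier (KS \<O> \<sigma>)"
    then show "r * p \<in> gb_scheme_ideal \<O> \<sigma>"
      unfolding gb_scheme_ideal_iff by (intro conjI J'(4) mult_in_poly_ring p KS_subset_Kc)
  }
qed (auto simp: gb_scheme_ideal_iff ideal_poly_ringD(2)[OF ideal_J])

lemma gb_in_KS: "f \<in> gb_scheme_ideal \<O> \<sigma> \<Longrightarrow> f \<in> carrier (KS \<O> \<sigma>)"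
  by (rule ideal_poly_ringD(1)[OF ideal_gb])

abbreviation gb_part :: "('x + 'x cidx, 'k::field) mpoly set"
  where "gb_part \<equiv> Idl\<^bsub>KxS \<O> \<sigma>\<^esub> (rename Inr ` gb_scheme_ideal \<O> \<sigma>)"
abbreviation g_part :: "('x + 'x cidx, 'k::field) mpoly set"
  where "g_part \<equiv> Idl\<^bsub>KxS \<O> \<sigma>\<^esub> (g_star \<O> \<sigma> ` corners \<O>)"

lemma generators_in_KxS:
  "rename Inr ` gb_scheme_ideal \<O> \<sigma> \<subseteq> carrier (KxS \<O> \<sigma>)" "g_star \<O> \<sigma> ` corners \<O> \<subseteq> carrier (KxS \<O> \<sigma>)"
  using rename_Inr_in_KxS[OF gb_in_KS] g_star_in_KxS by blast+

lemma ideal_U: "ideal (U_ideal \<O> \<sigma>) (KxS \<O> \<sigma>)"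
  unfolding U_ideal_def
  by (intro ring.add_ideals ring.genideal_ideal ring_poly_ring generators_in_KxS)

lemma gb_in_U: "f \<in> gb_scheme_ideal \<O> \<sigma> \<Longrightarrow> rename Inr f \<in> U_ideal \<O> \<sigma>"
proof -
  assume "f \<in> gb_scheme_ideal \<O> \<sigma>"
  then have "rename Inr f \<in> gb_part"
    using ring.genideal_self[OF ring_poly_ring generators_in_KxS(1)] by blast
  moreover have "0 \<in> g_part"
    by (rule ideal_poly_ringD(2)[OF ring.genideal_ideal[OF ring_poly_ring generators_in_KxS(2)]])
  ultimately show "rename Inr f \<in> U_ideal \<O> \<sigma>"
    unfolding U_ideal_def set_add_poly_ring by force
qed

lemma g_star_in_U: "b \<in> corners \<O> \<Longrightarrow> g_star \<O> \<sigma> b \<in> U_ideal \<O> \<sigma>"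
proof -
  assume "b \<in> corners \<O>"
  then have "g_star \<O> \<sigma> b \<in> g_part"
    using ring.genideal_self[OF ring_poly_ring generators_in_KxS(2)] by blast
  moreover have "0 \<in> gb_part"
    by (rule ideal_poly_ringD(2)[OF ring.genideal_ideal[OF ring_poly_ring generators_in_KxS(1)]])
  ultimately show "g_star \<O> \<sigma> b \<in> U_ideal \<O> \<sigma>"
    unfolding U_ideal_def set_add_poly_ring by force
qed

lemma U_ideal_minimal:
  assumes A: "ideal A (KxS \<O> \<sigma>)" and "\<And>f. f \<in> gb_scheme_ideal \<O> \<sigma> \<Longrightarrow> rename Inr f \<in> A"
    and "\<And>b. b \<in> corners \<O> \<Longrightarrow> g_star \<O> \<sigma> b \<in> A"
  shows "U_ideal \<O> \<sigma> \<subseteq> A"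
proof -
  have "gb_part \<subseteq> A" "g_part \<subseteq> A"
    using assms by (intro ring.genideal_minimal[OF ring_poly_ring A]; blast)+
  then show ?thesis
    unfolding U_ideal_def set_add_poly_ring using ideal_poly_ringD(3)[OF A] by blast
qed

text \<open>
  The description of \<open>Psi\<close> by \<open>the_elem\<close> is independent of the representative because
  \<open>gb_scheme_ideal \<O> \<sigma>\<close> is mapped into \<open>U_ideal \<O> \<sigma>\<close>.
\<close>

lemma Psi_coset:
  assumes "f \<in> carrier (KS \<O> \<sigma>)"
  shows "Psi \<O> \<sigma> (gb_scheme_ideal \<O> \<sigma> +>\<^bsub>KS \<O> \<sigma>\<^esub> f) = U_ideal \<O> \<sigma> +>\<^bsub>KxS \<O> \<sigma>\<^esub> rename Inr f"
proof -
  have "U_ideal \<O> \<sigma> +>\<^bsub>KxS \<O> \<sigma>\<^esub> rename Inr (i + f) = U_ideal \<O> \<sigma> +>\<^bsub>KxS \<O> \<sigma>\<^esub> rename Inr f"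
    if "i \<in> gb_scheme_ideal \<O> \<sigma>" for i
  proof -
    have c: "rename Inr (i + f) \<in> carrier (KxS \<O> \<sigma>)" "rename Inr f \<in> carrier (KxS \<O> \<sigma>)"
      by (intro rename_Inr_in_KxS add_in_poly_ring assms gb_in_KS that)+
    have "rename Inr (i + f) - rename Inr f \<in> U_ideal \<O> \<sigma>" by (simp add: gb_in_U[OF that])
    then show ?thesis using coset_eq_iff[OF ideal_U c] by blast
  qed
  then have "(\<lambda>g. U_ideal \<O> \<sigma> +>\<^bsub>KxS \<O> \<sigma>\<^esub> rename Inr g) ` (gb_scheme_ideal \<O> \<sigma> +>\<^bsub>KS \<O> \<sigma>\<^esub> f)
      = {U_ideal \<O> \<sigma> +>\<^bsub>KxS \<O> \<sigma>\<^esub> rename Inr f}"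
    unfolding coset_poly_ring[OF ideal_gb] using ideal_poly_ringD(2)[OF ideal_gb] by blast
  then show ?thesis unfolding Psi_def by simp
qed

section \<open>The maximal ideal of a rational point\<close>

text \<open>
  The polynomials congruent to their value at \<open>a\<close> contain the constants and, by hypothesis, the
  indeterminates, and they are closed under sums and products.
\<close>

lemma KS_diff_value:
  assumes A: "ideal A (KS \<O> \<sigma>)" and lin: "\<And>c. c \<in> S_corner \<O> \<sigma> \<Longrightarrow> Var c - Const (a c) \<in> A"
    and "f \<in> carrier (KS \<O> \<sigma>)"
  shows "f \<in> carrier (KS \<O> \<sigma>) \<and> f - Const (subst id a f) \<in> A"
  using assms(3)
proof (induction f rule: poly_ring_induct)
  case (Const c)
  show ?case
    by (simp only: id_hom.subst_Const) (simp add: ideal_poly_ringD(2)[OF A])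
next
  case (Var c)
  then show ?case by (simp only: id_hom.subst_Var lin Var_in_poly_ring simp_thms)
next
  case (add p q)
  have "p + q - Const (subst id a (p + q)) = (p - Const (subst id a p)) + (q - Const (subst id a q))"
    by (simp add: Const_add)
  then have "p + q - Const (subst id a (p + q)) \<in> A"
    using ideal_poly_ringD(3)[OF A conjunct2[OF add(1)] conjunct2[OF add(2)]] by (simp only:)
  then show ?case using add add_in_poly_ring by blast
next
  case (mult p q)
  have "p * q - Const (subst id a (p * q)) = p * (q - Const (subst id a q)) + Const (subst id a q) * (p - Const (subst id a p))"
    by (simp add: Const_mult algebra_simps)
  moreover have "p * (q - Const (subst id a q)) + Const (subst id a q) * (p - Const (subst id a p)) \<in> A"
    by (rule ideal_poly_ringD(3)[OF A ideal_poly_ringD(4)[OF A conjunct1[OF mult(1)] conjunct2[OF mult(2)]]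
      ideal_poly_ringD(4)[OF A Const_in_poly_ring conjunct2[OF mult(1)]]])
  ultimately have "p * q - Const (subst id a (p * q)) \<in> A" by (simp only:)
  then show ?case using mult mult_in_poly_ring by blast
qed

text \<open>
  As for \<open>KS_diff_value\<close>, with specialization in place of evaluation: it leaves the \<open>x\<^sub>k\<close> unchanged, so
  these are congruent to their specialization for trivial reasons.
\<close>

lemma KxS_diff_specialize:
  assumes A: "ideal A (KxS \<O> \<sigma>)" and lin: "\<And>c. c \<in> S_corner \<O> \<sigma> \<Longrightarrow> Var (Inr c) - Const (a c) \<in> A"
    and "f \<in> carrier (KxS \<O> \<sigma>)"
  shows "f \<in> carrier (KxS \<O> \<sigma>) \<and> f - rename Inl (specialize a f) \<in> A"
  using assms(3)
proof (induction f rule: poly_ring_induct)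
  case (Const c)
  then show ?case using ideal_poly_ringD(2)[OF A] by simp
next
  case (Var v)
  have "Var v - rename Inl (specialize a (Var v)) \<in> A"
  proof (cases v)
    case (Inl k)
    then show ?thesis by (simp add: ideal_poly_ringD(2)[OF A])
  next
    case (Inr c)
    then have "c \<in> S_corner \<O> \<sigma>" using Var by auto
    then show ?thesis using lin by (simp add: Inr)
  qed
  then show ?case using Var_in_poly_ring[OF Var] by (rule conjI[rotated])
next
  case (add p q)
  have "p + q - rename Inl (specialize a (p + q)) = (p - rename Inl (specialize a p)) + (q - rename Inl (specialize a q))"
    by (simp only: rename_simps specialize_simps add_diff_add)
  then have "p + q - rename Inl (specialize a (p + q)) \<in> A"
    using ideal_poly_ringD(3)[OF A conjunct2[OF add(1)] conjunct2[OF add(2)]] by (simp only:)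
  then show ?case using add_in_poly_ring[OF conjunct1[OF add(1)] conjunct1[OF add(2)]] by (rule conjI[rotated])
next
  case (mult p q)
  have "p * q - rename Inl (specialize a (p * q))
      = p * (q - rename Inl (specialize a q)) + rename Inl (specialize a q) * (p - rename Inl (specialize a p))"
    by (simp add: algebra_simps)
  moreover have "p * (q - rename Inl (specialize a q)) + rename Inl (specialize a q) * (p - rename Inl (specialize a p)) \<in> A"
    by (rule ideal_poly_ringD(3)[OF A ideal_poly_ringD(4)[OF A conjunct1[OF mult(1)] conjunct2[OF mult(2)]]
      ideal_poly_ringD(4)[OF A rename_Inl_in_KxS conjunct2[OF mult(1)]]])
  ultimately have "p * q - rename Inl (specialize a (p * q)) \<in> A" by (simp only:)
  then show ?case using mult_in_poly_ring[OF conjunct1[OF mult(1)] conjunct1[OF mult(2)]] by (rule conjI[rotated])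
qed

end

locale rational_point = term_order_ideal +
  fixes a :: "('a::finite) cidx \<Rightarrow> 'k::field"
  assumes rational: "a \<in> rational_points \<O> \<sigma>"
begin

lemma gb_vanish: "f \<in> gb_scheme_ideal \<O> \<sigma> \<Longrightarrow> subst id a f = 0"
  using rational by (simp add: rational_points_def)

text \<open>
  The maximal ideal of \<open>a\<close> in \<open>K[S]\<close>. Its image in \<open>G_ring \<O> \<sigma>\<close> contains \<open>point_ideal \<O> \<sigma> a\<close>,
  which keeps the class of 1 out of the latter.
\<close>

abbreviation M :: "('a cidx, 'k) mpoly set" where "M \<equiv> {f \<in> carrier (KS \<O> \<sigma>). subst id a f = 0}"

lemma ideal_M: "ideal M (KS \<O> \<sigma>)"
  by (rule ideal_vanishing)

lemma gb_subset_M: "gb_scheme_ideal \<O> \<sigma> \<subseteq> M"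
  using gb_vanish gb_in_KS by auto

lemma lin_in_KS: "c \<in> S_corner \<O> \<sigma> \<Longrightarrow> Var c - Const (a c) \<in> carrier (KS \<O> \<sigma>)"
  by (intro poly_ring_closed Const_in_poly_ring)

lemma ring_G: "ring (G_ring \<O> \<sigma>)"
  unfolding G_ring_def by (rule ideal.quotient_is_ring[OF ideal_gb])

lemma point_generators_in_G:
  "(\<lambda>c. gb_scheme_ideal \<O> \<sigma> +>\<^bsub>KS \<O> \<sigma>\<^esub> (Var c - Const (a c))) ` S_corner \<O> \<sigma> \<subseteq> carrier (G_ring \<O> \<sigma>)"
  unfolding G_ring_def using coset_in_quot[OF ideal_gb] lin_in_KS by blast

lemma ideal_point: "ideal (point_ideal \<O> \<sigma> a) (G_ring \<O> \<sigma>)"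
  unfolding point_ideal_def by (rule ring.genideal_ideal[OF ring_G point_generators_in_G])

lemma point_ideal_subset: "point_ideal \<O> \<sigma> a \<subseteq> (+>\<^bsub>KS \<O> \<sigma>\<^esub>) (gb_scheme_ideal \<O> \<sigma>) ` M"
  unfolding point_ideal_def
proof (rule ring.genideal_minimal[OF ring_G])
  show "ideal ((+>\<^bsub>KS \<O> \<sigma>\<^esub>) (gb_scheme_ideal \<O> \<sigma>) ` M) (G_ring \<O> \<sigma>)"
    unfolding G_ring_def by (rule ideal_coset_image[OF ideal_gb ideal_M])
  show "(\<lambda>c. gb_scheme_ideal \<O> \<sigma> +>\<^bsub>KS \<O> \<sigma>\<^esub> (Var c - Const (a c))) ` S_corner \<O> \<sigma>
      \<subseteq> (+>\<^bsub>KS \<O> \<sigma>\<^esub>) (gb_scheme_ideal \<O> \<sigma>) ` M"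
  proof (rule image_subsetI, rule imageI)
    show "Var c - Const (a c) \<in> M" if "c \<in> S_corner \<O> \<sigma>" for c
      using lin_in_KS[OF that] by simp
  qed
qed

lemma lin_in_point_ideal:
  "c \<in> S_corner \<O> \<sigma> \<Longrightarrow> gb_scheme_ideal \<O> \<sigma> +>\<^bsub>KS \<O> \<sigma>\<^esub> (Var c - Const (a c)) \<in> point_ideal \<O> \<sigma> a"
  unfolding point_ideal_def using ring.genideal_self[OF ring_G point_generators_in_G] by blast

text \<open>
  A class outside the point ideal differs by an element of it from a nonzero constant, namely the
  value at \<open>a\<close>, and constants are units.
\<close>

lemma maximal_point_ideal: "maximalideal (point_ideal \<O> \<sigma> a) (G_ring \<O> \<sigma>)"
proof (rule maximalidealI)
  show "ideal (point_ideal \<O> \<sigma> a) (G_ring \<O> \<sigma>)" by (rule ideal_point)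
  show "carrier (G_ring \<O> \<sigma>) \<noteq> point_ideal \<O> \<sigma> a"
  proof
    assume "carrier (G_ring \<O> \<sigma>) = point_ideal \<O> \<sigma> a"
    then have "gb_scheme_ideal \<O> \<sigma> +>\<^bsub>KS \<O> \<sigma>\<^esub> 1 \<in> (+>\<^bsub>KS \<O> \<sigma>\<^esub>) (gb_scheme_ideal \<O> \<sigma>) ` M"
      using point_ideal_subset coset_in_quot[OF ideal_gb one_in_poly_ring] unfolding G_ring_def by blast
    then have "1 \<in> M" using coset_mem_image_iff[OF ideal_gb ideal_M gb_subset_M one_in_poly_ring] by blast
    then show False by simp
  qed
  fix Q assume Q: "ideal Q (G_ring \<O> \<sigma>)" "point_ideal \<O> \<sigma> a \<subseteq> Q" "Q \<subseteq> carrier (G_ring \<O> \<sigma>)"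
  define A where "A B = {f \<in> carrier (KS \<O> \<sigma>). gb_scheme_ideal \<O> \<sigma> +>\<^bsub>KS \<O> \<sigma>\<^esub> f \<in> B}"
    for B :: "('a cidx, 'k) mpoly set set"
  have ideal_A: "ideal (A B) (KS \<O> \<sigma>)" if "ideal B (G_ring \<O> \<sigma>)" for B
    using ideal_coset_vimage[OF ideal_gb] that unfolding A_def G_ring_def by blast
  have diff: "f - Const (subst id a f) \<in> A (point_ideal \<O> \<sigma> a)" if "f \<in> carrier (KS \<O> \<sigma>)" for f
    using KS_diff_value[OF ideal_A[OF ideal_point] _ that] lin_in_point_ideal lin_in_KS unfolding A_def by blast
  show "Q = point_ideal \<O> \<sigma> a \<or> Q = carrier (G_ring \<O> \<sigma>)"
  proof (cases "Q \<subseteq> point_ideal \<O> \<sigma> a")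
    case False
    then obtain X where X: "X \<in> Q" "X \<notin> point_ideal \<O> \<sigma> a" by blast
    then obtain f where f: "f \<in> carrier (KS \<O> \<sigma>)" "X = gb_scheme_ideal \<O> \<sigma> +>\<^bsub>KS \<O> \<sigma>\<^esub> f"
      using quotE[OF ideal_gb] Q(3) unfolding G_ring_def by blast
    define e where "e = subst id a f"
    have "f \<notin> A (point_ideal \<O> \<sigma> a)" using X(2) f by (simp add: A_def)
    then have "e \<noteq> 0" using diff[OF f(1)] unfolding e_def by fastforce
    have "f \<in> A Q" using f X(1) by (simp add: A_def)
    moreover have "f - Const e \<in> A Q" using diff[OF f(1)] Q(2) unfolding A_def e_def by blast
    ultimately have "f - (f - Const e) \<in> A Q" by (rule ideal_poly_ringD(6)[OF ideal_A[OF Q(1)]])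
    then have "Const e \<in> A Q" by simp
    then have "Const (1 / e) * Const e \<in> A Q" by (intro ideal_poly_ringD(4)[OF ideal_A[OF Q(1)]]) simp
    then have "1 \<in> A Q" using \<open>e \<noteq> 0\<close> by (simp flip: Const_mult)
    then have "\<one>\<^bsub>G_ring \<O> \<sigma>\<^esub> \<in> Q" by (simp add: A_def G_ring_def FactRing_def)
    then show ?thesis using ideal.one_imp_carrier[OF Q(1)] by blast
  qed (use Q(2) in blast)
qed

section \<open>The fiber over a rational point\<close>

abbreviation Ia :: "('a, 'k) mpoly set" where "Ia \<equiv> point_to_ideal \<O> \<sigma> a"
text \<open>
  The kernel of \<open>K[x, S] \<rightarrow> P/I\<^sub>a\<close>, to be compared with the preimage of \<open>fiber_ideal\<close>.
\<close>

abbreviation W :: "('a + 'a cidx, 'k) mpoly set"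
  where "W \<equiv> {f \<in> carrier (KxS \<O> \<sigma>). specialize a f \<in> Ia}"
abbreviation FI :: "('a + 'a cidx, 'k) mpoly set set"
  where "FI \<equiv> fiber_ideal \<O> \<sigma> (point_ideal \<O> \<sigma> a)"

lemma ideal_Ia: "ideal Ia P_ring"
  unfolding point_to_ideal_eq by (rule ideal_prebasis_ideal)

lemma ideal_W: "ideal W (KxS \<O> \<sigma>)"
  using ideal_P_ringD[OF ideal_Ia] by (auto simp: ideal_poly_ring_iff intro: poly_ring_closed)

lemma U_subset_W: "U_ideal \<O> \<sigma> \<subseteq> W"
proof (rule U_ideal_minimal[OF ideal_W])
  show "rename Inr f \<in> W" if "f \<in> gb_scheme_ideal \<O> \<sigma>" for f
    using rename_Inr_in_KxS[OF gb_in_KS[OF that]] gb_vanish[OF that] ideal_P_ringD(1)[OF ideal_Ia] by simp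
  show "g_star \<O> \<sigma> b \<in> W" if "b \<in> corners \<O>" for b
    using g_star_in_KxS[OF that] prebasis_in_ideal[OF that, of a] by (simp add: specialize_g_star point_to_ideal_eq)
qed

lemma ring_U: "ring (U_ring \<O> \<sigma>)"
  unfolding U_ring_def by (rule ideal.quotient_is_ring[OF ideal_U])

lemma Psi_point_ideal:
  assumes "X \<in> point_ideal \<O> \<sigma> a"
  shows "Psi \<O> \<sigma> X \<in> (+>\<^bsub>KxS \<O> \<sigma>\<^esub>) (U_ideal \<O> \<sigma>) ` W"
proof -
  obtain f where f: "f \<in> carrier (KS \<O> \<sigma>)" "subst id a f = 0" "X = gb_scheme_ideal \<O> \<sigma> +>\<^bsub>KS \<O> \<sigma>\<^esub> f"
    using assms point_ideal_subset by blast
  have "rename Inr f \<in> W"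
    using rename_Inr_in_KxS[OF f(1)] f(2) ideal_P_ringD(1)[OF ideal_Ia] by simp
  then show ?thesis unfolding f(3) Psi_coset[OF f(1)] by blast
qed

lemma ideal_UW: "ideal ((+>\<^bsub>KxS \<O> \<sigma>\<^esub>) (U_ideal \<O> \<sigma>) ` W) (U_ring \<O> \<sigma>)"
  unfolding U_ring_def by (rule ideal_coset_image[OF ideal_U ideal_W])

lemma Psi_image_subset: "Psi \<O> \<sigma> ` point_ideal \<O> \<sigma> a \<subseteq> carrier (U_ring \<O> \<sigma>)"
  using Psi_point_ideal additive_subgroup.a_subset[OF ideal.axioms(1)[OF ideal_UW]] by blast

lemma ideal_FI: "ideal FI (U_ring \<O> \<sigma>)"
  unfolding fiber_ideal_def by (rule ring.genideal_ideal[OF ring_U Psi_image_subset])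

lemma FI_subset: "FI \<subseteq> (+>\<^bsub>KxS \<O> \<sigma>\<^esub>) (U_ideal \<O> \<sigma>) ` W"
  unfolding fiber_ideal_def by (rule ring.genideal_minimal[OF ring_U ideal_UW]) (use Psi_point_ideal in blast)

text \<open>
  The fiber ideal is generated by classes of elements of \<open>W\<close>, which gives one direction. Conversely, let
  \<open>A\<close> be the preimage of the fiber ideal in \<open>K[x, S]\<close>. It contains all \<open>c - a\<^sub>c\<close>, so \<open>f\<close> and its specialization
  are congruent modulo \<open>A\<close>. In particular the specialized prebasis lies in \<open>A\<close> together with
  the \<open>g\<^sub>b\<^sup>*\<close>, and with it all of \<open>I\<^sub>a\<close>.
\<close>

lemma coset_in_FI_iff:
  assumes "f \<in> carrier (KxS \<O> \<sigma>)"
  shows "U_ideal \<O> \<sigma> +>\<^bsub>KxS \<O> \<sigma>\<^esub> f \<in> FI \<longleftrightarrow> specialize a f \<in> Ia"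
proof
  assume "U_ideal \<O> \<sigma> +>\<^bsub>KxS \<O> \<sigma>\<^esub> f \<in> FI"
  then have "f \<in> W" using FI_subset coset_mem_image_iff[OF ideal_U ideal_W U_subset_W assms] by blast
  then show "specialize a f \<in> Ia" by blast
next
  define A where "A = {f \<in> carrier (KxS \<O> \<sigma>). U_ideal \<O> \<sigma> +>\<^bsub>KxS \<O> \<sigma>\<^esub> f \<in> FI}"
  have ideal_A: "ideal A (KxS \<O> \<sigma>)"
    using ideal_coset_vimage[OF ideal_U] ideal_FI unfolding A_def U_ring_def by blast
  have "Var (Inr c) - Const (a c) \<in> A" if "c \<in> S_corner \<O> \<sigma>" for c
  proof -
    have "Psi \<O> \<sigma> (gb_scheme_ideal \<O> \<sigma> +>\<^bsub>KS \<O> \<sigma>\<^esub> (Var c - Const (a c))) \<in> FI"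
      unfolding fiber_ideal_def
      using ring.genideal_self[OF ring_U Psi_image_subset] lin_in_point_ideal[OF that] by blast
    then have "U_ideal \<O> \<sigma> +>\<^bsub>KxS \<O> \<sigma>\<^esub> rename Inr (Var c - Const (a c)) \<in> FI"
      unfolding Psi_coset[OF lin_in_KS[OF that]] .
    then show ?thesis
      using rename_Inr_in_KxS[OF lin_in_KS[OF that]] by (simp add: A_def)
  qed
  then have diff: "f - rename Inl (specialize a f) \<in> A" if "f \<in> carrier (KxS \<O> \<sigma>)" for f
    using KxS_diff_specialize[OF ideal_A _ that] by blast
  have U_A: "f \<in> A" if "f \<in> U_ideal \<O> \<sigma>" for f
  proof -
    have "U_ideal \<O> \<sigma> +>\<^bsub>KxS \<O> \<sigma>\<^esub> f = \<zero>\<^bsub>U_ring \<O> \<sigma>\<^esub>"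
      using ring.a_rcos_zero[OF ring_poly_ring ideal_U that] by (simp add: U_ring_def FactRing_def)
    then show ?thesis
      using additive_subgroup.zero_closed[OF ideal.axioms(1)[OF ideal_FI]] ideal_poly_ringD(1)[OF ideal_U that]
      by (simp add: A_def)
  qed
  have "ideal {p. rename Inl p \<in> A} P_ring"
  proof (rule ideal_P_ringI)
    show "r * p \<in> {p. rename Inl p \<in> A}" if "p \<in> {p. rename Inl p \<in> A}" for r p
      using that ideal_poly_ringD(4)[OF ideal_A rename_Inl_in_KxS] by simp
  qed (use ideal_poly_ringD[OF ideal_A] in auto)
  moreover have "prebasis a b \<in> {p. rename Inl p \<in> A}" if "b \<in> corners \<O>" for b
  proof -
    have "g_star \<O> \<sigma> b - (g_star \<O> \<sigma> b - rename Inl (specialize a (g_star \<O> \<sigma> b))) \<in> A"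
      using ideal_poly_ringD(6)[OF ideal_A U_A[OF g_star_in_U[OF that]] diff[OF g_star_in_KxS[OF that]]] .
    then show ?thesis by (simp add: specialize_g_star)
  qed
  ultimately have Ia_A: "Ia \<subseteq> {p. rename Inl p \<in> A}"
    unfolding point_to_ideal_eq by (intro ring.genideal_minimal[OF ring_P_ring]) auto
  assume "specialize a f \<in> Ia"
  then have "(f - rename Inl (specialize a f)) + rename Inl (specialize a f) \<in> A"
    using Ia_A by (intro ideal_poly_ringD(3)[OF ideal_A diff[OF assms]]) blast
  then show "U_ideal \<O> \<sigma> +>\<^bsub>KxS \<O> \<sigma>\<^esub> f \<in> FI" by (simp add: A_def)
qed

lemma fiber_iso: "fiber_iso_quotient \<O> \<sigma> (point_ideal \<O> \<sigma> a) Ia"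
proof -
  let ?q = "fiber_class \<O> \<sigma> (point_ideal \<O> \<sigma> a)"
  let ?h = "\<lambda>f. Ia +>\<^bsub>P_ring\<^esub> specialize a f"
  have "?q = (+>\<^bsub>U_ring \<O> \<sigma>\<^esub>) FI \<circ> (+>\<^bsub>KxS \<O> \<sigma>\<^esub>) (U_ideal \<O> \<sigma>)"
    by (simp add: fun_eq_iff fiber_class_def)
  have UI_hom: "(+>\<^bsub>KxS \<O> \<sigma>\<^esub>) (U_ideal \<O> \<sigma>) \<in> ring_hom (KxS \<O> \<sigma>) (U_ring \<O> \<sigma>)"
    unfolding U_ring_def by (rule ideal.rcos_ring_hom[OF ideal_U])
  have FI_hom: "(+>\<^bsub>U_ring \<O> \<sigma>\<^esub>) FI \<in> ring_hom (U_ring \<O> \<sigma>) (fiber \<O> \<sigma> (point_ideal \<O> \<sigma> a))"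
    unfolding fiber_def by (rule ideal.rcos_ring_hom[OF ideal_FI])
  have q_hom: "?q \<in> ring_hom (KxS \<O> \<sigma>) (fiber \<O> \<sigma> (point_ideal \<O> \<sigma> a))"
    using ring_hom_trans[OF UI_hom FI_hom] \<open>?q = _\<close> by simp
  have q_surj: "?q ` carrier (KxS \<O> \<sigma>) = carrier (fiber \<O> \<sigma> (point_ideal \<O> \<sigma> a))"
  proof -
    have "carrier (fiber \<O> \<sigma> (point_ideal \<O> \<sigma> a)) = (+>\<^bsub>U_ring \<O> \<sigma>\<^esub>) FI ` carrier (U_ring \<O> \<sigma>)"
      by (auto simp: fiber_def FactRing_def A_RCOSETS_def')
    also have "carrier (U_ring \<O> \<sigma>) = (+>\<^bsub>KxS \<O> \<sigma>\<^esub>) (U_ideal \<O> \<sigma>) ` carrier (KxS \<O> \<sigma>)"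
      unfolding U_ring_def by (rule coset_image_carrier[OF ideal_U, symmetric])
    finally show ?thesis by (simp only: \<open>?q = _\<close> image_comp)
  qed
  have spec_hom: "specialize a \<in> ring_hom (KxS \<O> \<sigma>) P_ring"
    by (rule ring_hom_memI) simp_all
  have h_hom: "?h \<in> ring_hom (KxS \<O> \<sigma>) (P_ring Quot Ia)"
    using ring_hom_trans[OF spec_hom ideal.rcos_ring_hom[OF ideal_Ia]] by (simp add: comp_def)
  have spec_surj: "specialize a ` carrier (KxS \<O> \<sigma>) = UNIV"
    using rename_Inl_in_KxS specialize_rename_Inl by (metis surjI UNIV_eq_I image_eqI)
  have "?h ` carrier (KxS \<O> \<sigma>) = (\<lambda>p. Ia +>\<^bsub>P_ring\<^esub> p) ` (specialize a ` carrier (KxS \<O> \<sigma>))"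
    by (simp add: image_comp comp_def)
  also have "\<dots> = carrier (P_ring Quot Ia)"
    unfolding spec_surj by (auto simp: FactRing_def A_RCOSETS_def')
  finally have h_surj: "?h ` carrier (KxS \<O> \<sigma>) = carrier (P_ring Quot Ia)" .
  have ker: "?q f = \<zero>\<^bsub>fiber \<O> \<sigma> (point_ideal \<O> \<sigma> a)\<^esub> \<longleftrightarrow> ?h f = \<zero>\<^bsub>P_ring Quot Ia\<^esub>"
    if f: "f \<in> carrier (KxS \<O> \<sigma>)" for f
  proof -
    have Uf: "U_ideal \<O> \<sigma> +>\<^bsub>KxS \<O> \<sigma>\<^esub> f \<in> carrier (U_ring \<O> \<sigma>)"
      unfolding U_ring_def by (rule coset_in_quot[OF ideal_U f])
    have "?q f = \<zero>\<^bsub>fiber \<O> \<sigma> (point_ideal \<O> \<sigma> a)\<^esub> \<longleftrightarrow> U_ideal \<O> \<sigma> +>\<^bsub>KxS \<O> \<sigma>\<^esub> f \<in> FI"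
      using ideal.rcos_const_imp_mem[OF ideal_FI Uf] ring.a_rcos_zero[OF ring_U ideal_FI]
      by (auto simp: fiber_class_def fiber_def FactRing_def)
    also have "\<dots> \<longleftrightarrow> specialize a f \<in> Ia" by (rule coset_in_FI_iff[OF f])
    also have "\<dots> \<longleftrightarrow> ?h f = \<zero>\<^bsub>P_ring Quot Ia\<^esub>"
      using coset_eq_zero_iff[of Ia UNIV "specialize a f"] ideal_Ia
      by (simp add: FactRing_def P_ring_def)
    finally show ?thesis .
  qed
  have "ring (fiber \<O> \<sigma> (point_ideal \<O> \<sigma> a))" "ring (P_ring Quot Ia)"
    unfolding fiber_def by (rule ideal.quotient_is_ring, rule ideal_FI, rule ideal.quotient_is_ring, rule ideal_Ia)
  from ring_iso_of_equal_kernels[OF ring_poly_ring this q_hom q_surj h_hom h_surj ker]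
  obtain \<phi> where \<phi>: "\<phi> \<in> ring_iso (fiber \<O> \<sigma> (point_ideal \<O> \<sigma> a)) (P_ring Quot Ia)"
    "\<And>f. f \<in> carrier (KxS \<O> \<sigma>) \<Longrightarrow> \<phi> (?q f) = ?h f" by blast
  have "\<phi> (?q (rename Inl p)) = Ia +>\<^bsub>P_ring\<^esub> p" for p
    using \<phi>(2)[OF rename_Inl_in_KxS, of p] by simp
  with \<phi>(1) show ?thesis unfolding fiber_iso_quotient_def by blast
qed

end

theorem corollary2p11:
  fixes \<O> :: "('x::finite) trm set" and \<sigma> :: "'x trm rel"
  assumes "order_ideal \<O>" and "term_ordering \<sigma>"
  shows
    "bij_betw (point_to_ideal \<O> \<sigma>)
       (rational_points \<O> \<sigma> :: ('x cidx \<Rightarrow> 'k::field) set) (ideals_with_complement \<O> \<sigma>)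
     \<and>
     (\<forall>a\<in>(rational_points \<O> \<sigma> :: ('x cidx \<Rightarrow> 'k) set).
        maximalideal (point_ideal \<O> \<sigma> a) (G_ring \<O> \<sigma>) \<and>
        fiber_iso_quotient \<O> \<sigma> (point_ideal \<O> \<sigma> a) (point_to_ideal \<O> \<sigma> a) \<and>
        reduced_groebner_basis \<sigma> (point_to_ideal \<O> \<sigma> a) (specialized_prebasis \<O> \<sigma> a))
     \<and>
     (\<forall>I\<in>(ideals_with_complement \<O> \<sigma> :: ('x, 'k) mpoly set set).
        \<exists>a\<in>rational_points \<O> \<sigma>. fiber_iso_quotient \<O> \<sigma> (point_ideal \<O> \<sigma> a) I)"
proof -
  interpret term_order_ideal \<sigma> \<O> by unfold_locales (fact assms)+
  have bij: "bij_betw (point_to_ideal \<O> \<sigma>)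
      (rational_points \<O> \<sigma> :: ('x cidx \<Rightarrow> 'k) set) (ideals_with_complement \<O> \<sigma>)"
    by (rule bij_betw_point_to_ideal)
  have point: "rational_point \<sigma> \<O> a" if "a \<in> rational_points \<O> \<sigma>" for a :: "'x cidx \<Rightarrow> 'k"
    by unfold_locales (fact that)
  have "\<exists>a\<in>rational_points \<O> \<sigma>. fiber_iso_quotient \<O> \<sigma> (point_ideal \<O> \<sigma> a) I"
    if I: "I \<in> ideals_with_complement \<O> \<sigma>" for I :: "('x, 'k) mpoly set"
  proof -
    obtain a where "a \<in> rational_points \<O> \<sigma>" "I = point_to_ideal \<O> \<sigma> a"
      using I bij_betw_imp_surj_on[OF bij] by (metis imageE)
    then show ?thesis using rational_point.fiber_iso[OF point] by blast
  qed
  then show ?thesis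
    using bij rational_point.maximal_point_ideal[OF point] rational_point.fiber_iso[OF point]
      rational_point_reduced_groebner by blast
qed

end
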